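(* If $\Gamma\vdash C_r\dashv\Omega$ is derivable in ordered adjoint natural deduction with explicit structural rules, then $\Gamma\vdash C_r\rhd\Xi$ is derivable in implicit ordered adjoint natural deduction for some set $\Xi$ with $\mathsf{NF}_{\Gamma,r}(\Omega)\subseteq\Xi$.
   Context: Modes and propositions. Fix a preorder $(\mathcal{M},\geq)$ of modes and, for each mode $m$, a set $\sigma(m)\subseteq\{\mathsf{W},\mathsf{C}^\leftarrow,\mathsf{C}^\rightarrow,\mathsf{M}^\leftarrow,\mathsf{M}^\rightarrow\}$, monotone ($k\geq m$ implies $\sigma(k)\supseteq\sigma(m)$), and satisfying: if $\mathsf{W},\mathsf{C}^\leftarrow\in\sigma(m)$ then $\mathsf{M}^\leftarrow\in\sigma(m)$; if $\mathsf{W},\mathsf{C}^\rightarrow\in\sigma(m)$ then $\mathsf{M}^\rightarrow\in\sigma(m)$. Propositions: $A_m ::= P_m \mid A_m \rightarrowtail B_m \mid A_m \twoheadrightarrow B_m \mid A_m \,\&\, B_m \mid {\uparrow}^m_l A_l\ (m\geq l) \mid A_m\bullet B_m \mid 1_m \mid A_m\oplus B_m \mid {\downarrow}^k_m A_k\ (k\geq m)$. An ordered context $\Omega$ is a finite sequence of labeled hypotheses $x{:}A_m$ (repetitions allowed, same variable always same proposition); $|\Omega|$ its variable set; $\Omega\geq m$ means all its hypotheses $y{:}B_k$ have $k\geq m$; $\Omega$ is normal if no variable repeats. Explicit natural deduction $\Gamma\vdash A_m\dashv\Omega$ ($\Gamma$ unordered set of hypotheses, $\Omega$ ordered used hypotheses).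 Rules: (hyp) $x{:}A_m\in\Gamma\Rightarrow\Gamma\vdash A_m\dashv(x{:}A_m)$; ($1I$) $\Rightarrow\Gamma\vdash1_m\dashv\cdot$; ($1E$) $\Gamma\vdash1_m\dashv\Omega_M$, $m\geq r$, $\Gamma\vdash C_r\dashv\Omega_L\Omega_R\Rightarrow\Gamma\vdash C_r\dashv\Omega_L\Omega_M\Omega_R$; ($\bullet I$) $\Gamma\vdash A_m\dashv\Omega_L,\Gamma\vdash B_m\dashv\Omega_R\Rightarrow\Gamma\vdash A_m\bullet B_m\dashv\Omega_L\Omega_R$; ($\bullet E$) $\Gamma\vdash A_m\bullet B_m\dashv\Omega_M$, $m\geq r$, $x,y\notin|\Omega_L\Omega_R|$, $\Gamma,x{:}A_m,y{:}B_m\vdash C_r\dashv\Omega_L(x{:}A_m)(y{:}B_m)\Omega_R\Rightarrow\Gamma\vdash C_r\dashv\Omega_L\Omega_M\Omega_R$; ($\oplus I_i$) $\Gamma\vdash A_m\dashv\Omega$ (resp. $B_m$) $\Rightarrow\Gamma\vdash A_m\oplus B_m\dashv\Omega$; ($\oplus E$) $\Gamma\vdash A_m\oplus B_m\dashv\Omega_M$, $m\geq r$, $x\notin|\Omega_L\Omega_R|$, $\Gamma,x{:}A_m\vdash C_r\dashv\Omega_L(x{:}A_m)\Omega_R$, $\Gamma,x{:}B_m\vdash C_r\dashv\Omega_L(x{:}B_m)\Omega_R\Rightarrow\Gamma\vdash C_r\dashv\Omega_L\Omega_M\Omega_R$; (${\downarrow}I$) $\Gamma\vdash A_k\dashv\Omega\Rightarrow\Gamma\vdash{\downarrow}^k_mA_k\dashv\Omega$;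 (${\downarrow}E$) $\Gamma\vdash{\downarrow}^k_mA_k\dashv\Omega_M$, $m\geq r$, $\Gamma,x{:}A_k\vdash C_r\dashv\Omega_L(x{:}A_k)\Omega_R$, $x\notin|\Omega_L\Omega_R|\Rightarrow\Gamma\vdash C_r\dashv\Omega_L\Omega_M\Omega_R$; ($\twoheadrightarrow I$) $\Gamma,x{:}A_m\vdash B_m\dashv\Omega(x{:}A_m)$, $x\notin|\Omega|\Rightarrow\Gamma\vdash A_m\twoheadrightarrow B_m\dashv\Omega$; ($\twoheadrightarrow E$) $\Gamma\vdash A_m\twoheadrightarrow B_m\dashv\Omega_L,\Gamma\vdash A_m\dashv\Omega_R\Rightarrow\Gamma\vdash B_m\dashv\Omega_L\Omega_R$; ($\rightarrowtail I$) $\Gamma,x{:}A_m\vdash B_m\dashv(x{:}A_m)\Omega$, $x\notin|\Omega|\Rightarrow\Gamma\vdash A_m\rightarrowtail B_m\dashv\Omega$; ($\rightarrowtail E$) $\Gamma\vdash A_m\rightarrowtail B_m\dashv\Omega_R,\Gamma\vdash A_m\dashv\Omega_L\Rightarrow\Gamma\vdash B_m\dashv\Omega_L\Omega_R$; ($\&I$) $\Gamma\vdash A_m\dashv\Omega,\Gamma\vdash B_m\dashv\Omega\Rightarrow\Gamma\vdash A_m\&B_m\dashv\Omega$; ($\&E_i$) $\Gamma\vdash A_m\&B_m\dashv\Omega\Rightarrow\Gamma\vdash A_m\dashv\Omega$ (resp. $B_m$); (${\uparrow}I$) $\Gamma\vdash A_l\dashv\Omega$, $\Omega\geq m\Rightarrow\Gamma\vdash{\uparrow}^m_lA_l\dashv\Omega$;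 (${\uparrow}E$) $\Gamma\vdash{\uparrow}^l_kA_k\dashv\Omega\Rightarrow\Gamma\vdash A_k\dashv\Omega$; structural: ($\mathsf{W}$) $\Gamma\vdash C_r\dashv\Omega_L\Omega_R$, $x{:}A_m\in\Gamma$, $m\geq r$, $\mathsf{W}\in\sigma(m)\Rightarrow\Gamma\vdash C_r\dashv\Omega_L(x{:}A_m)\Omega_R$; ($\mathsf{C}^\rightarrow$) $\Gamma\vdash C_r\dashv\Omega_L(x{:}A_m)\Omega_M(x{:}A_m)\Omega_R$, $\mathsf{C}^\rightarrow\in\sigma(m)\Rightarrow\Gamma\vdash C_r\dashv\Omega_L\Omega_M(x{:}A_m)\Omega_R$; ($\mathsf{C}^\leftarrow$) same premise, $\mathsf{C}^\leftarrow\in\sigma(m)\Rightarrow\Gamma\vdash C_r\dashv\Omega_L(x{:}A_m)\Omega_M\Omega_R$; ($\mathsf{M}^\rightarrow$) $\Gamma\vdash C_r\dashv\Omega_L(x{:}A_m)\Omega_M\Omega_R$, $\mathsf{M}^\rightarrow\in\sigma(m)\Rightarrow\Gamma\vdash C_r\dashv\Omega_L\Omega_M(x{:}A_m)\Omega_R$; ($\mathsf{M}^\leftarrow$) $\Gamma\vdash C_r\dashv\Omega_L\Omega_M(x{:}A_m)\Omega_R$, $\mathsf{M}^\leftarrow\in\sigma(m)\Rightarrow\Gamma\vdash C_r\dashv\Omega_L(x{:}A_m)\Omega_M\Omega_R$. Context reduction $\Omega\leadsto^{\Gamma}_{r}\Omega'$: generated by (W) $\Omega_L(x{:}A_m)\Omega_R\leadsto\Omega'$,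 $\mathsf{W}\in\sigma(m)$, $m\geq r$, $x{:}A_m\in\Gamma$, $x\notin|\Omega_L\Omega_R|\Rightarrow\Omega_L\Omega_R\leadsto\Omega'$; ($\mathsf{C}^\leftarrow$) $\Omega_L(x{:}A_m)\Omega_M\Omega_R\leadsto\Omega'$, $\mathsf{C}^\leftarrow\in\sigma(m)\Rightarrow\Omega_L(x{:}A_m)\Omega_M(x{:}A_m)\Omega_R\leadsto\Omega'$; ($\mathsf{C}^\rightarrow$) $\Omega_L\Omega_M(x{:}A_m)\Omega_R\leadsto\Omega'$, $\mathsf{C}^\rightarrow\in\sigma(m)\Rightarrow\Omega_L(x{:}A_m)\Omega_M(x{:}A_m)\Omega_R\leadsto\Omega'$; ($\mathsf{M}^\leftarrow$) $\Omega_L(x{:}A_m)\Omega_M\Omega_R\leadsto\Omega'$, $\mathsf{M}^\leftarrow\in\sigma(m)\Rightarrow\Omega_L\Omega_M(x{:}A_m)\Omega_R\leadsto\Omega'$; ($\mathsf{M}^\rightarrow$) $\Omega_L\Omega_M(x{:}A_m)\Omega_R\leadsto\Omega'$, $\mathsf{M}^\rightarrow\in\sigma(m)\Rightarrow\Omega_L(x{:}A_m)\Omega_M\Omega_R\leadsto\Omega'$; (id) $\Omega$ normal $\Rightarrow\Omega\leadsto\Omega$. $\mathsf{NF}_{\Gamma,r}(\Omega)=\{\Omega'\mid\Omega\leadsto^{\Gamma}_{r}\Omega'\}$, extended to sets $\Xi$ of contexts by union. For sets of contexts, $\Xi_1\Xi_2=\{\Omega_1\Omega_2\mid\Omega_i\in\Xi_i\}$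 and $\Xi\Vert_m=\{\Omega\in\Xi\mid\Omega\geq m\}$. Implicit natural deduction: judgment $\Gamma\vdash A_m\rhd\Xi$, with $\Xi$ a set of normal contexts; a rule applies only if its output set is nonempty; $\mathsf{NF}$ without subscript means $\mathsf{NF}_{\Gamma,r}$ with $r$ the mode of the conclusion's proposition. Rules: (hyp) $x{:}A_m\in\Gamma\Rightarrow\Gamma\vdash A_m\rhd\mathsf{NF}(\{x{:}A_m\})$; ($1I$) $\Rightarrow\Gamma\vdash1_m\rhd\mathsf{NF}(\{\cdot\})$; ($1E$) $\Gamma\vdash1_m\rhd\Xi_M$, $m\geq r$, $\Gamma\vdash C_r\rhd\Xi'\Rightarrow\Gamma\vdash C_r\rhd\mathsf{NF}(\{\Omega_L\Omega_M\Omega_R\mid\Omega_L\Omega_R\in\Xi',\Omega_M\in\Xi_M\})$ (over all splittings); ($\bullet I$) $\Gamma\vdash A_m\rhd\Xi_L$, $\Gamma\vdash B_m\rhd\Xi_R\Rightarrow\Gamma\vdash A_m\bullet B_m\rhd\mathsf{NF}_{\Gamma,m}(\Xi_L\Xi_R)$; ($\bullet E$) $\Gamma\vdash A_m\bullet B_m\rhd\Xi_M$, $m\geq r$, $\Gamma,x{:}A_m,y{:}B_m\vdash C_r\rhd\Xi\Rightarrow\Gamma\vdash C_r\rhd\mathsf{NF}(\{\Omega_L\Omega_M\Omega_R\mid\Omega_L(x{:}A_m)(y{:}B_m)\Omega_R\in\Xi,\Omega_M\in\Xi_M\})$; ($\oplus I_i$) $\Gamma\vdash A_m\rhd\Xi$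 (resp. $B_m$) $\Rightarrow\Gamma\vdash A_m\oplus B_m\rhd\Xi$; ($\oplus E$) $\Gamma\vdash A_m\oplus B_m\rhd\Xi_M$, $m\geq r$, $\Gamma,x{:}A_m\vdash C_r\rhd\Xi_A$, $\Gamma,x{:}B_m\vdash C_r\rhd\Xi_B\Rightarrow\Gamma\vdash C_r\rhd\mathsf{NF}(\{\Omega_L\Omega_M\Omega_R\mid\Omega_L(x{:}A_m)\Omega_R\in\Xi_A,\Omega_L(x{:}B_m)\Omega_R\in\Xi_B,\Omega_M\in\Xi_M\})$; (${\downarrow}I$) $\Gamma\vdash A_l\rhd\Xi\Rightarrow\Gamma\vdash{\downarrow}^l_mA_l\rhd\mathsf{NF}_{\Gamma,m}(\Xi)$; (${\downarrow}E$) $\Gamma\vdash{\downarrow}^l_mA_l\rhd\Xi_M$, $m\geq r$, $\Gamma,x{:}A_l\vdash C_r\rhd\Xi\Rightarrow\Gamma\vdash C_r\rhd\mathsf{NF}_{\Gamma,r}(\{\Omega_L\Omega_M\Omega_R\mid\Omega_L(x{:}A_l)\Omega_R\in\Xi,\Omega_M\in\Xi_M\})$; ($\twoheadrightarrow I$) $\Gamma,x{:}A_m\vdash B_m\rhd\Xi'\Rightarrow\Gamma\vdash A_m\twoheadrightarrow B_m\rhd\{\Omega\mid\Omega(x{:}A_m)\in\Xi'\}$; ($\twoheadrightarrow E$) $\Gamma\vdash A_m\twoheadrightarrow B_m\rhd\Xi_L$, $\Gamma\vdash A_m\rhd\Xi_R\Rightarrow\Gamma\vdash B_m\rhd\mathsf{NF}(\Xi_L\Xi_R)$;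 ($\rightarrowtail I$) $\Gamma,x{:}A_m\vdash B_m\rhd\Xi'\Rightarrow\Gamma\vdash A_m\rightarrowtail B_m\rhd\{\Omega\mid(x{:}A_m)\Omega\in\Xi'\}$; ($\rightarrowtail E$) $\Gamma\vdash A_m\rightarrowtail B_m\rhd\Xi_R$, $\Gamma\vdash A_m\rhd\Xi_L\Rightarrow\Gamma\vdash B_m\rhd\mathsf{NF}(\Xi_L\Xi_R)$; ($\&I$) $\Gamma\vdash A_m\rhd\Xi_A$, $\Gamma\vdash B_m\rhd\Xi_B\Rightarrow\Gamma\vdash A_m\&B_m\rhd\Xi_A\cap\Xi_B$; ($\&E_i$) $\Gamma\vdash A_m\&B_m\rhd\Xi\Rightarrow\Gamma\vdash A_m\rhd\Xi$ (resp. $B_m$); (${\uparrow}I$) $\Gamma\vdash A_k\rhd\Xi\Rightarrow\Gamma\vdash{\uparrow}^m_kA_k\rhd\Xi\Vert_m$; (${\uparrow}E$) $\Gamma\vdash{\uparrow}^m_kA_k\rhd\Xi\Rightarrow\Gamma\vdash A_k\rhd\mathsf{NF}_{\Gamma,k}(\Xi)$.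
   Formalization: The formal theorem additionally assumes that NF_{Γ,r}(Ω) is nonempty; without this the claim fails, e.g. with no structural rules Γ={x:P} gives P•P explicitly with Ω=(x:P)(x:P), but P•P has no implicit derivation, since rule outputs must be nonempty. *)

theory Defs
  imports Main
begin

(* Arrows ending in L point to the left, arrows ending in R to the right:
   ContrL/ContrR are C with left/right arrow, MobL/MobR are M with left/right arrow. *)
datatype structural = Weak | ContrL | ContrR | MobL | MobR

definition adjoint_modes :: "('m::preorder \<Rightarrow> structural set) \<Rightarrow> bool" where
  "adjoint_modes \<sigma> \<longleftrightarrow>
     (\<forall>k m. k \<ge> m \<longrightarrow> \<sigma> k \<supseteq> \<sigma> m) \<and>
     (\<forall>m. Weak \<in> \<sigma> m \<and> ContrL \<in> \<sigma> m \<longrightarrow> MobL \<in> \<sigma> m) \<and>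
     (\<forall>m. Weak \<in> \<sigma> m \<and> ContrR \<in> \<sigma> m \<longrightarrow> MobR \<in> \<sigma> m)"

(* LImp is the tailed arrow (argument used at the left end of the context), RImp the
   two-headed arrow (argument used at the right end).  Only atoms, units and shifts carry a
   mode: in Up m A (the shift from mode_of A up to m) and Down m A (the shift from mode_of A
   down to m) the annotation is the mode of the whole proposition.  Every other mode is
   recovered by mode_of, and wf_form says that the raw term is well-moded. *)
datatype ('m, 'p) form =
    Atom 'm 'p
  | LImp "('m, 'p) form" "('m, 'p) form"
  | RImp "('m, 'p) form" "('m, 'p) form"
  | With "('m, 'p) form" "('m, 'p) form"
  | Up 'm "('m, 'p) form"
  | Fuse "('m, 'p) form" "('m, 'p) form"
  | One 'm
  | Plus "('m, 'p) form" "('m, 'p) form"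
  | Down 'm "('m, 'p) form"

primrec mode_of :: "('m, 'p) form \<Rightarrow> 'm" where
  "mode_of (Atom m p) = m"
| "mode_of (LImp A B) = mode_of A"
| "mode_of (RImp A B) = mode_of A"
| "mode_of (With A B) = mode_of A"
| "mode_of (Up m A) = m"
| "mode_of (Fuse A B) = mode_of A"
| "mode_of (One m) = m"
| "mode_of (Plus A B) = mode_of A"
| "mode_of (Down m A) = m"

primrec wf_form :: "('m::preorder, 'p) form \<Rightarrow> bool" where
  "wf_form (Atom m p) \<longleftrightarrow> True"
| "wf_form (LImp A B) \<longleftrightarrow> wf_form A \<and> wf_form B \<and> mode_of A = mode_of B"
| "wf_form (RImp A B) \<longleftrightarrow> wf_form A \<and> wf_form B \<and> mode_of A = mode_of B"
| "wf_form (With A B) \<longleftrightarrow> wf_form A \<and> wf_form B \<and> mode_of A = mode_of B"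
| "wf_form (Up m A) \<longleftrightarrow> wf_form A \<and> m \<ge> mode_of A"
| "wf_form (Fuse A B) \<longleftrightarrow> wf_form A \<and> wf_form B \<and> mode_of A = mode_of B"
| "wf_form (One m) \<longleftrightarrow> True"
| "wf_form (Plus A B) \<longleftrightarrow> wf_form A \<and> wf_form B \<and> mode_of A = mode_of B"
| "wf_form (Down m A) \<longleftrightarrow> wf_form A \<and> mode_of A \<ge> m"

type_synonym ('v, 'm, 'p) hyps = "('v \<times> ('m, 'p) form) set"
type_synonym ('v, 'm, 'p) octx = "('v \<times> ('m, 'p) form) list"

definition wf_hyps :: "('v, 'm::preorder, 'p) hyps \<Rightarrow> bool" where
  "wf_hyps \<Gamma> \<longleftrightarrow> single_valued \<Gamma> \<and> (\<forall>(x, A) \<in> \<Gamma>. wf_form A)"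

definition vars :: "('v, 'm, 'p) octx \<Rightarrow> 'v set" where
  "vars \<Omega> = fst ` set \<Omega>"

definition ctx_ge :: "('v, 'm::preorder, 'p) octx \<Rightarrow> 'm \<Rightarrow> bool" where
  "ctx_ge \<Omega> m \<longleftrightarrow> (\<forall>(y, B) \<in> set \<Omega>. mode_of B \<ge> m)"

definition normal_ctx :: "('v, 'm, 'p) octx \<Rightarrow> bool" where
  "normal_ctx \<Omega> \<longleftrightarrow> distinct (map fst \<Omega>)"

(* In both deductive systems, extending the hypotheses by x:A presupposes that x is not yet
   declared (x \<notin> Domain \<Gamma>), and introduction rules require the introduced
   proposition to be well-moded.  The mode r of the conclusion is mode_of C. *)
inductive explicit_nd ::
  "('m::preorder \<Rightarrow> structural set) \<Rightarrow> ('v, 'm, 'p) hyps \<Rightarrow> ('m, 'p) form \<Rightarrow> ('v, 'm, 'p) octx \<Rightarrow> bool"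
  for \<sigma> :: "'m::preorder \<Rightarrow> structural set"
where
  e_hyp: "(x, A) \<in> \<Gamma> \<Longrightarrow> explicit_nd \<sigma> \<Gamma> A [(x, A)]"
| e_OneI: "explicit_nd \<sigma> \<Gamma> (One m) []"
| e_OneE: "\<lbrakk>explicit_nd \<sigma> \<Gamma> (One m) \<Omega>M; m \<ge> mode_of C; explicit_nd \<sigma> \<Gamma> C (\<Omega>L @ \<Omega>R)\<rbrakk>
    \<Longrightarrow> explicit_nd \<sigma> \<Gamma> C (\<Omega>L @ \<Omega>M @ \<Omega>R)"
| e_FuseI: "\<lbrakk>wf_form (Fuse A B); explicit_nd \<sigma> \<Gamma> A \<Omega>L; explicit_nd \<sigma> \<Gamma> B \<Omega>R\<rbrakk>
    \<Longrightarrow> explicit_nd \<sigma> \<Gamma> (Fuse A B) (\<Omega>L @ \<Omega>R)"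
| e_FuseE: "\<lbrakk>explicit_nd \<sigma> \<Gamma> (Fuse A B) \<Omega>M; mode_of (Fuse A B) \<ge> mode_of C;
     x \<notin> Domain \<Gamma>; y \<notin> Domain \<Gamma>; x \<noteq> y;
     x \<notin> vars (\<Omega>L @ \<Omega>R); y \<notin> vars (\<Omega>L @ \<Omega>R);
     explicit_nd \<sigma> (\<Gamma> \<union> {(x, A), (y, B)}) C (\<Omega>L @ [(x, A)] @ [(y, B)] @ \<Omega>R)\<rbrakk>
    \<Longrightarrow> explicit_nd \<sigma> \<Gamma> C (\<Omega>L @ \<Omega>M @ \<Omega>R)"
| e_PlusI1: "\<lbrakk>wf_form (Plus A B); explicit_nd \<sigma> \<Gamma> A \<Omega>\<rbrakk> \<Longrightarrow> explicit_nd \<sigma> \<Gamma> (Plus A B) \<Omega>"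
| e_PlusI2: "\<lbrakk>wf_form (Plus A B); explicit_nd \<sigma> \<Gamma> B \<Omega>\<rbrakk> \<Longrightarrow> explicit_nd \<sigma> \<Gamma> (Plus A B) \<Omega>"
| e_PlusE: "\<lbrakk>explicit_nd \<sigma> \<Gamma> (Plus A B) \<Omega>M; mode_of (Plus A B) \<ge> mode_of C;
     x \<notin> Domain \<Gamma>; x \<notin> vars (\<Omega>L @ \<Omega>R);
     explicit_nd \<sigma> (\<Gamma> \<union> {(x, A)}) C (\<Omega>L @ [(x, A)] @ \<Omega>R);
     explicit_nd \<sigma> (\<Gamma> \<union> {(x, B)}) C (\<Omega>L @ [(x, B)] @ \<Omega>R)\<rbrakk>
    \<Longrightarrow> explicit_nd \<sigma> \<Gamma> C (\<Omega>L @ \<Omega>M @ \<Omega>R)"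
| e_DownI: "\<lbrakk>wf_form (Down m A); explicit_nd \<sigma> \<Gamma> A \<Omega>\<rbrakk> \<Longrightarrow> explicit_nd \<sigma> \<Gamma> (Down m A) \<Omega>"
| e_DownE: "\<lbrakk>explicit_nd \<sigma> \<Gamma> (Down m A) \<Omega>M; m \<ge> mode_of C;
     x \<notin> Domain \<Gamma>; x \<notin> vars (\<Omega>L @ \<Omega>R);
     explicit_nd \<sigma> (\<Gamma> \<union> {(x, A)}) C (\<Omega>L @ [(x, A)] @ \<Omega>R)\<rbrakk>
    \<Longrightarrow> explicit_nd \<sigma> \<Gamma> C (\<Omega>L @ \<Omega>M @ \<Omega>R)"
| e_RImpI: "\<lbrakk>wf_form (RImp A B); x \<notin> Domain \<Gamma>; x \<notin> vars \<Omega>;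
     explicit_nd \<sigma> (\<Gamma> \<union> {(x, A)}) B (\<Omega> @ [(x, A)])\<rbrakk>
    \<Longrightarrow> explicit_nd \<sigma> \<Gamma> (RImp A B) \<Omega>"
| e_RImpE: "\<lbrakk>explicit_nd \<sigma> \<Gamma> (RImp A B) \<Omega>L; explicit_nd \<sigma> \<Gamma> A \<Omega>R\<rbrakk>
    \<Longrightarrow> explicit_nd \<sigma> \<Gamma> B (\<Omega>L @ \<Omega>R)"
| e_LImpI: "\<lbrakk>wf_form (LImp A B); x \<notin> Domain \<Gamma>; x \<notin> vars \<Omega>;
     explicit_nd \<sigma> (\<Gamma> \<union> {(x, A)}) B ([(x, A)] @ \<Omega>)\<rbrakk>
    \<Longrightarrow> explicit_nd \<sigma> \<Gamma> (LImp A B) \<Omega>"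
| e_LImpE: "\<lbrakk>explicit_nd \<sigma> \<Gamma> (LImp A B) \<Omega>R; explicit_nd \<sigma> \<Gamma> A \<Omega>L\<rbrakk>
    \<Longrightarrow> explicit_nd \<sigma> \<Gamma> B (\<Omega>L @ \<Omega>R)"
| e_WithI: "\<lbrakk>wf_form (With A B); explicit_nd \<sigma> \<Gamma> A \<Omega>; explicit_nd \<sigma> \<Gamma> B \<Omega>\<rbrakk>
    \<Longrightarrow> explicit_nd \<sigma> \<Gamma> (With A B) \<Omega>"
| e_WithE1: "explicit_nd \<sigma> \<Gamma> (With A B) \<Omega> \<Longrightarrow> explicit_nd \<sigma> \<Gamma> A \<Omega>"
| e_WithE2: "explicit_nd \<sigma> \<Gamma> (With A B) \<Omega> \<Longrightarrow> explicit_nd \<sigma> \<Gamma> B \<Omega>"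
| e_UpI: "\<lbrakk>wf_form (Up m A); explicit_nd \<sigma> \<Gamma> A \<Omega>; ctx_ge \<Omega> m\<rbrakk> \<Longrightarrow> explicit_nd \<sigma> \<Gamma> (Up m A) \<Omega>"
| e_UpE: "explicit_nd \<sigma> \<Gamma> (Up m A) \<Omega> \<Longrightarrow> explicit_nd \<sigma> \<Gamma> A \<Omega>"
| e_Weak: "\<lbrakk>explicit_nd \<sigma> \<Gamma> C (\<Omega>L @ \<Omega>R); (x, A) \<in> \<Gamma>; mode_of A \<ge> mode_of C; Weak \<in> \<sigma> (mode_of A)\<rbrakk>
    \<Longrightarrow> explicit_nd \<sigma> \<Gamma> C (\<Omega>L @ [(x, A)] @ \<Omega>R)"
| e_ContrR: "\<lbrakk>explicit_nd \<sigma> \<Gamma> C (\<Omega>L @ [(x, A)] @ \<Omega>M @ [(x, A)] @ \<Omega>R); ContrR \<in> \<sigma> (mode_of A)\<rbrakk>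
    \<Longrightarrow> explicit_nd \<sigma> \<Gamma> C (\<Omega>L @ \<Omega>M @ [(x, A)] @ \<Omega>R)"
| e_ContrL: "\<lbrakk>explicit_nd \<sigma> \<Gamma> C (\<Omega>L @ [(x, A)] @ \<Omega>M @ [(x, A)] @ \<Omega>R); ContrL \<in> \<sigma> (mode_of A)\<rbrakk>
    \<Longrightarrow> explicit_nd \<sigma> \<Gamma> C (\<Omega>L @ [(x, A)] @ \<Omega>M @ \<Omega>R)"
| e_MobR: "\<lbrakk>explicit_nd \<sigma> \<Gamma> C (\<Omega>L @ [(x, A)] @ \<Omega>M @ \<Omega>R); MobR \<in> \<sigma> (mode_of A)\<rbrakk>
    \<Longrightarrow> explicit_nd \<sigma> \<Gamma> C (\<Omega>L @ \<Omega>M @ [(x, A)] @ \<Omega>R)"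
| e_MobL: "\<lbrakk>explicit_nd \<sigma> \<Gamma> C (\<Omega>L @ \<Omega>M @ [(x, A)] @ \<Omega>R); MobL \<in> \<sigma> (mode_of A)\<rbrakk>
    \<Longrightarrow> explicit_nd \<sigma> \<Gamma> C (\<Omega>L @ [(x, A)] @ \<Omega>M @ \<Omega>R)"

(* ctx_red \<sigma> \<Gamma> r \<Omega> \<Omega>': the premise of each rule is the context after the step, so
   weakening adds a hypothesis and contraction removes one. *)
inductive ctx_red ::
  "('m::preorder \<Rightarrow> structural set) \<Rightarrow> ('v, 'm, 'p) hyps \<Rightarrow> 'm
    \<Rightarrow> ('v, 'm, 'p) octx \<Rightarrow> ('v, 'm, 'p) octx \<Rightarrow> bool"
  for \<sigma> :: "'m::preorder \<Rightarrow> structural set" and \<Gamma> :: "('v, 'm, 'p) hyps" and r :: 'm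
where
  r_Weak: "\<lbrakk>ctx_red \<sigma> \<Gamma> r (\<Omega>L @ [(x, A)] @ \<Omega>R) \<Omega>'; Weak \<in> \<sigma> (mode_of A); mode_of A \<ge> r;
     (x, A) \<in> \<Gamma>; x \<notin> vars (\<Omega>L @ \<Omega>R)\<rbrakk>
    \<Longrightarrow> ctx_red \<sigma> \<Gamma> r (\<Omega>L @ \<Omega>R) \<Omega>'"
| r_ContrL: "\<lbrakk>ctx_red \<sigma> \<Gamma> r (\<Omega>L @ [(x, A)] @ \<Omega>M @ \<Omega>R) \<Omega>'; ContrL \<in> \<sigma> (mode_of A)\<rbrakk>
    \<Longrightarrow> ctx_red \<sigma> \<Gamma> r (\<Omega>L @ [(x, A)] @ \<Omega>M @ [(x, A)] @ \<Omega>R) \<Omega>'"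
| r_ContrR: "\<lbrakk>ctx_red \<sigma> \<Gamma> r (\<Omega>L @ \<Omega>M @ [(x, A)] @ \<Omega>R) \<Omega>'; ContrR \<in> \<sigma> (mode_of A)\<rbrakk>
    \<Longrightarrow> ctx_red \<sigma> \<Gamma> r (\<Omega>L @ [(x, A)] @ \<Omega>M @ [(x, A)] @ \<Omega>R) \<Omega>'"
| r_MobL: "\<lbrakk>ctx_red \<sigma> \<Gamma> r (\<Omega>L @ [(x, A)] @ \<Omega>M @ \<Omega>R) \<Omega>'; MobL \<in> \<sigma> (mode_of A)\<rbrakk>
    \<Longrightarrow> ctx_red \<sigma> \<Gamma> r (\<Omega>L @ \<Omega>M @ [(x, A)] @ \<Omega>R) \<Omega>'"
| r_MobR: "\<lbrakk>ctx_red \<sigma> \<Gamma> r (\<Omega>L @ \<Omega>M @ [(x, A)] @ \<Omega>R) \<Omega>'; MobR \<in> \<sigma> (mode_of A)\<rbrakk>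
    \<Longrightarrow> ctx_red \<sigma> \<Gamma> r (\<Omega>L @ [(x, A)] @ \<Omega>M @ \<Omega>R) \<Omega>'"
| r_id: "normal_ctx \<Omega> \<Longrightarrow> ctx_red \<sigma> \<Gamma> r \<Omega> \<Omega>"

definition NF ::
  "('m::preorder \<Rightarrow> structural set) \<Rightarrow> ('v, 'm, 'p) hyps \<Rightarrow> 'm
    \<Rightarrow> ('v, 'm, 'p) octx \<Rightarrow> ('v, 'm, 'p) octx set" where
  "NF \<sigma> \<Gamma> r \<Omega> = {\<Omega>'. ctx_red \<sigma> \<Gamma> r \<Omega> \<Omega>'}"

definition NFs ::
  "('m::preorder \<Rightarrow> structural set) \<Rightarrow> ('v, 'm, 'p) hyps \<Rightarrow> 'm
    \<Rightarrow> ('v, 'm, 'p) octx set \<Rightarrow> ('v, 'm, 'p) octx set" where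
  "NFs \<sigma> \<Gamma> r \<Xi> = (\<Union>\<Omega>\<in>\<Xi>. NF \<sigma> \<Gamma> r \<Omega>)"

definition juxt ::
  "('v, 'm, 'p) octx set \<Rightarrow> ('v, 'm, 'p) octx set \<Rightarrow> ('v, 'm, 'p) octx set" where
  "juxt \<Xi>1 \<Xi>2 = {\<Omega>1 @ \<Omega>2 | \<Omega>1 \<Omega>2. \<Omega>1 \<in> \<Xi>1 \<and> \<Omega>2 \<in> \<Xi>2}"

definition restr ::
  "('v, 'm::preorder, 'p) octx set \<Rightarrow> 'm \<Rightarrow> ('v, 'm, 'p) octx set" where
  "restr \<Xi> m = {\<Omega> \<in> \<Xi>. ctx_ge \<Omega> m}"

(* In each rule \<Xi> is the output set, and \<Xi> \<noteq> {} is the side condition that the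
   output be nonempty.  Rules whose output is that of a premise inherit it.  Hence no
   derivable \<Xi> is empty, and NF \<sigma> \<Gamma> r \<Omega> = {} can happen for explicitly derivable
   \<Omega>: without structural rules, x:P yields Fuse P P with context [x:P, x:P], which has no
   normal form, and Fuse P P is not implicitly derivable from x:P. *)
inductive implicit_nd ::
  "('m::preorder \<Rightarrow> structural set) \<Rightarrow> ('v, 'm, 'p) hyps \<Rightarrow> ('m, 'p) form \<Rightarrow> ('v, 'm, 'p) octx set \<Rightarrow> bool"
  for \<sigma> :: "'m::preorder \<Rightarrow> structural set"
where
  i_hyp: "\<lbrakk>(x, A) \<in> \<Gamma>; \<Xi> = NFs \<sigma> \<Gamma> (mode_of A) {[(x, A)]}; \<Xi> \<noteq> {}\<rbrakk>
    \<Longrightarrow> implicit_nd \<sigma> \<Gamma> A \<Xi>"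
| i_OneI: "\<lbrakk>\<Xi> = NFs \<sigma> \<Gamma> m {[]}; \<Xi> \<noteq> {}\<rbrakk> \<Longrightarrow> implicit_nd \<sigma> \<Gamma> (One m) \<Xi>"
| i_OneE: "\<lbrakk>implicit_nd \<sigma> \<Gamma> (One m) \<Xi>M; m \<ge> mode_of C; implicit_nd \<sigma> \<Gamma> C \<Xi>';
     \<Xi> = NFs \<sigma> \<Gamma> (mode_of C) {\<Omega>L @ \<Omega>M @ \<Omega>R | \<Omega>L \<Omega>M \<Omega>R. \<Omega>L @ \<Omega>R \<in> \<Xi>' \<and> \<Omega>M \<in> \<Xi>M}; \<Xi> \<noteq> {}\<rbrakk>
    \<Longrightarrow> implicit_nd \<sigma> \<Gamma> C \<Xi>"
| i_FuseI: "\<lbrakk>wf_form (Fuse A B); implicit_nd \<sigma> \<Gamma> A \<Xi>L; implicit_nd \<sigma> \<Gamma> B \<Xi>R;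
     \<Xi> = NFs \<sigma> \<Gamma> (mode_of (Fuse A B)) (juxt \<Xi>L \<Xi>R); \<Xi> \<noteq> {}\<rbrakk>
    \<Longrightarrow> implicit_nd \<sigma> \<Gamma> (Fuse A B) \<Xi>"
| i_FuseE: "\<lbrakk>implicit_nd \<sigma> \<Gamma> (Fuse A B) \<Xi>M; mode_of (Fuse A B) \<ge> mode_of C;
     x \<notin> Domain \<Gamma>; y \<notin> Domain \<Gamma>; x \<noteq> y;
     implicit_nd \<sigma> (\<Gamma> \<union> {(x, A), (y, B)}) C \<Xi>';
     \<Xi> = NFs \<sigma> \<Gamma> (mode_of C) {\<Omega>L @ \<Omega>M @ \<Omega>R | \<Omega>L \<Omega>M \<Omega>R.
            \<Omega>L @ [(x, A)] @ [(y, B)] @ \<Omega>R \<in> \<Xi>' \<and> \<Omega>M \<in> \<Xi>M}; \<Xi> \<noteq> {}\<rbrakk>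
    \<Longrightarrow> implicit_nd \<sigma> \<Gamma> C \<Xi>"
| i_PlusI1: "\<lbrakk>wf_form (Plus A B); implicit_nd \<sigma> \<Gamma> A \<Xi>\<rbrakk> \<Longrightarrow> implicit_nd \<sigma> \<Gamma> (Plus A B) \<Xi>"
| i_PlusI2: "\<lbrakk>wf_form (Plus A B); implicit_nd \<sigma> \<Gamma> B \<Xi>\<rbrakk> \<Longrightarrow> implicit_nd \<sigma> \<Gamma> (Plus A B) \<Xi>"
| i_PlusE: "\<lbrakk>implicit_nd \<sigma> \<Gamma> (Plus A B) \<Xi>M; mode_of (Plus A B) \<ge> mode_of C;
     x \<notin> Domain \<Gamma>;
     implicit_nd \<sigma> (\<Gamma> \<union> {(x, A)}) C \<Xi>A; implicit_nd \<sigma> (\<Gamma> \<union> {(x, B)}) C \<Xi>B;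
     \<Xi> = NFs \<sigma> \<Gamma> (mode_of C) {\<Omega>L @ \<Omega>M @ \<Omega>R | \<Omega>L \<Omega>M \<Omega>R.
            \<Omega>L @ [(x, A)] @ \<Omega>R \<in> \<Xi>A \<and> \<Omega>L @ [(x, B)] @ \<Omega>R \<in> \<Xi>B \<and> \<Omega>M \<in> \<Xi>M}; \<Xi> \<noteq> {}\<rbrakk>
    \<Longrightarrow> implicit_nd \<sigma> \<Gamma> C \<Xi>"
| i_DownI: "\<lbrakk>wf_form (Down m A); implicit_nd \<sigma> \<Gamma> A \<Xi>'; \<Xi> = NFs \<sigma> \<Gamma> m \<Xi>'; \<Xi> \<noteq> {}\<rbrakk>
    \<Longrightarrow> implicit_nd \<sigma> \<Gamma> (Down m A) \<Xi>"
| i_DownE: "\<lbrakk>implicit_nd \<sigma> \<Gamma> (Down m A) \<Xi>M; m \<ge> mode_of C; x \<notin> Domain \<Gamma>;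
     implicit_nd \<sigma> (\<Gamma> \<union> {(x, A)}) C \<Xi>';
     \<Xi> = NFs \<sigma> \<Gamma> (mode_of C) {\<Omega>L @ \<Omega>M @ \<Omega>R | \<Omega>L \<Omega>M \<Omega>R.
            \<Omega>L @ [(x, A)] @ \<Omega>R \<in> \<Xi>' \<and> \<Omega>M \<in> \<Xi>M}; \<Xi> \<noteq> {}\<rbrakk>
    \<Longrightarrow> implicit_nd \<sigma> \<Gamma> C \<Xi>"
| i_RImpI: "\<lbrakk>wf_form (RImp A B); x \<notin> Domain \<Gamma>; implicit_nd \<sigma> (\<Gamma> \<union> {(x, A)}) B \<Xi>';
     \<Xi> = {\<Omega>. \<Omega> @ [(x, A)] \<in> \<Xi>'}; \<Xi> \<noteq> {}\<rbrakk>
    \<Longrightarrow> implicit_nd \<sigma> \<Gamma> (RImp A B) \<Xi>"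
| i_RImpE: "\<lbrakk>implicit_nd \<sigma> \<Gamma> (RImp A B) \<Xi>L; implicit_nd \<sigma> \<Gamma> A \<Xi>R;
     \<Xi> = NFs \<sigma> \<Gamma> (mode_of B) (juxt \<Xi>L \<Xi>R); \<Xi> \<noteq> {}\<rbrakk>
    \<Longrightarrow> implicit_nd \<sigma> \<Gamma> B \<Xi>"
| i_LImpI: "\<lbrakk>wf_form (LImp A B); x \<notin> Domain \<Gamma>; implicit_nd \<sigma> (\<Gamma> \<union> {(x, A)}) B \<Xi>';
     \<Xi> = {\<Omega>. [(x, A)] @ \<Omega> \<in> \<Xi>'}; \<Xi> \<noteq> {}\<rbrakk>
    \<Longrightarrow> implicit_nd \<sigma> \<Gamma> (LImp A B) \<Xi>"
| i_LImpE: "\<lbrakk>implicit_nd \<sigma> \<Gamma> (LImp A B) \<Xi>R; implicit_nd \<sigma> \<Gamma> A \<Xi>L;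
     \<Xi> = NFs \<sigma> \<Gamma> (mode_of B) (juxt \<Xi>L \<Xi>R); \<Xi> \<noteq> {}\<rbrakk>
    \<Longrightarrow> implicit_nd \<sigma> \<Gamma> B \<Xi>"
| i_WithI: "\<lbrakk>wf_form (With A B); implicit_nd \<sigma> \<Gamma> A \<Xi>A; implicit_nd \<sigma> \<Gamma> B \<Xi>B;
     \<Xi> = \<Xi>A \<inter> \<Xi>B; \<Xi> \<noteq> {}\<rbrakk>
    \<Longrightarrow> implicit_nd \<sigma> \<Gamma> (With A B) \<Xi>"
| i_WithE1: "implicit_nd \<sigma> \<Gamma> (With A B) \<Xi> \<Longrightarrow> implicit_nd \<sigma> \<Gamma> A \<Xi>"
| i_WithE2: "implicit_nd \<sigma> \<Gamma> (With A B) \<Xi> \<Longrightarrow> implicit_nd \<sigma> \<Gamma> B \<Xi>"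
| i_UpI: "\<lbrakk>wf_form (Up m A); implicit_nd \<sigma> \<Gamma> A \<Xi>'; \<Xi> = restr \<Xi>' m; \<Xi> \<noteq> {}\<rbrakk>
    \<Longrightarrow> implicit_nd \<sigma> \<Gamma> (Up m A) \<Xi>"
| i_UpE: "\<lbrakk>implicit_nd \<sigma> \<Gamma> (Up m A) \<Xi>'; \<Xi> = NFs \<sigma> \<Gamma> (mode_of A) \<Xi>'; \<Xi> \<noteq> {}\<rbrakk>
    \<Longrightarrow> implicit_nd \<sigma> \<Gamma> A \<Xi>"

end

theory Submission
  imports Defs Complex_Main
begin

text \<open>
  A reduction of a context can be rearranged so that all contractions come first, then all
  moves, then all weakenings.  It is therefore determined by the choice, for every hypothesis
  of the original context, of the copy that survives contraction: without right contraction
  this must be the leftmost copy, without left contraction the rightmost one, and two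
  survivors may change places only if one of them is mobile in the required direction.

  Given two copies of a hypothesis, one that does not survive can therefore be contracted away
  in advance.  Repeating this inside a subcontext normalises it without changing what the whole
  context reduces to, so the derivation rules can be applied to normal forms of their premises.
  An explicit weakening is undone by letting another copy survive, which requires the mobility
  that accompanies weakening and contraction.
\<close>

section \<open>Reductions as choices of surviving copies\<close>

text \<open>Three features of the rules shape the auxiliary statements. A premise may have another
  mode or more hypotheses than its conclusion, and a weakening available to one need not be
  available to the other; the normal forms handed to the premises are therefore reached by
  contraction alone, which consults neither, and weakening is left to the outer reduction. In
  elimination rules the bound hypotheses stand where the conclusion has the used block, and the rule
  for \<open>Plus\<close> wants the same surroundings in both branches, so these are normalised
  independently of what they enclose. Finally, implicit rules demand nonempty outputs, so the
  existence of a normal form must be carried from the conclusion to each premise. Selections record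
  only the effect of a reduction: in the reduction itself, copies may pass one another before they
  are contracted, which hides the contraction that could have come first.\<close>

text \<open>
  Contexts are annotated with increasing rational keys, so that deleting, inserting or moving a
  hypothesis leaves the keys of the others unchanged.  The key of the copy of \<open>e\<close>
  that survives contraction is \<open>f e\<close>.
\<close>

abbreviation allows ::
  "('m::preorder \<Rightarrow> structural set) \<Rightarrow> structural \<Rightarrow> 'v \<times> ('m, 'p) form \<Rightarrow> bool" where
  "allows \<sigma> s e \<equiv> s \<in> \<sigma> (mode_of (snd e))"

definition keyed :: "(rat \<times> 'e) list \<Rightarrow> bool" where
  "keyed Z \<longleftrightarrow> sorted_wrt (\<lambda>a b. fst a < fst b) Z"

text \<open>Keys fix the order, so the annotated context can be a set and deleting a copy is a set
  difference. \<open>f\<close> is total, but only its values on hypotheses of \<open>S\<close>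
  matter.\<close>

definition selects ::
  "('m::preorder \<Rightarrow> structural set) \<Rightarrow> (rat \<times> 'v \<times> ('m, 'p) form) set
    \<Rightarrow> ('v \<times> ('m, 'p) form \<Rightarrow> rat) \<Rightarrow> bool" where
  "selects \<sigma> S f \<longleftrightarrow> (\<forall>e\<in>snd ` S. (f e, e) \<in> S) \<and>
     (\<forall>k e. (k, e) \<in> S \<longrightarrow> (allows \<sigma> ContrR e \<or> f e \<le> k) \<and> (allows \<sigma> ContrL e \<or> k \<le> f e))"

text \<open>In an inverted pair, \<open>d\<close> precedes \<open>e\<close> in
  \<open>\<Omega>'\<close> although the survivor of \<open>e\<close> lies further left. The two must
  cross: \<open>e\<close> moves right or \<open>d\<close> moves left. Hypotheses outside
  \<open>E\<close> are weakened in at their final places and cross nothing.\<close>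

definition sortable ::
  "('m::preorder \<Rightarrow> structural set) \<Rightarrow> ('v \<times> ('m, 'p) form) set
    \<Rightarrow> ('v \<times> ('m, 'p) form \<Rightarrow> rat) \<Rightarrow> ('v, 'm, 'p) octx \<Rightarrow> bool" where
  "sortable \<sigma> E f \<Omega>' \<longleftrightarrow>
     sorted_wrt (\<lambda>d e. d \<in> E \<and> e \<in> E \<and> f e < f d \<longrightarrow> allows \<sigma> MobR e \<or> allows \<sigma> MobL d) \<Omega>'"

definition realizes ::
  "('m::preorder \<Rightarrow> structural set) \<Rightarrow> ('v, 'm, 'p) hyps \<Rightarrow> 'm
    \<Rightarrow> (rat \<times> 'v \<times> ('m, 'p) form) set \<Rightarrow> ('v \<times> ('m, 'p) form \<Rightarrow> rat)
    \<Rightarrow> ('v, 'm, 'p) octx \<Rightarrow> bool" where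
  "realizes \<sigma> \<Gamma> r S f \<Omega>' \<longleftrightarrow> normal_ctx \<Omega>' \<and> snd ` S \<subseteq> set \<Omega>' \<and>
     (\<forall>e\<in>set \<Omega>' - snd ` S. allows \<sigma> Weak e \<and> mode_of (snd e) \<ge> r \<and> e \<in> \<Gamma>) \<and>
     selects \<sigma> S f \<and> sortable \<sigma> (snd ` S) f \<Omega>'"

section \<open>Contexts with increasing rational keys\<close>

lemma keyed_append:
  "keyed (Y @ Z) \<longleftrightarrow> keyed Y \<and> keyed Z \<and> (\<forall>a\<in>set Y. \<forall>b\<in>set Z. fst a < fst b)"
  by (simp add: keyed_def sorted_wrt_append)

lemma keyed_Cons:
  "keyed (a # Z) \<longleftrightarrow> (\<forall>b\<in>set Z. fst a < fst b) \<and> keyed Z"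
  by (simp add: keyed_def)

lemma keyed_Nil [simp]: "keyed []"
  by (simp add: keyed_def)

text \<open>Density provides the key between two nonempty sets, unboundedness the key beyond a
  single one.\<close>

lemma finite_separation:
  fixes A B :: "rat set"
  assumes "finite A" "finite B" "\<And>a b. a \<in> A \<Longrightarrow> b \<in> B \<Longrightarrow> a < b"
  shows "\<exists>k. (\<forall>a\<in>A. a < k) \<and> (\<forall>b\<in>B. k < b)"
proof (cases "A = {}")
  case True
  show ?thesis
  proof (cases "B = {}")
    case False
    obtain k where "k < Min B" using lt_ex by blast
    then show ?thesis using True assms(2) False by auto
  qed (use True in auto)
next
  case A: False
  show ?thesis
  proof (cases "B = {}")
    case True
    obtain k where "Max A < k" using gt_ex by blast
    then show ?thesis using A True assms(1) by auto
  next
    case False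
    have "Max A < Min B" using A False assms by simp
    then obtain k where "Max A < k" "k < Min B" using dense by blast
    then show ?thesis using A False assms(1,2) by auto
  qed
qed

lemma keyed_insert:
  assumes "keyed (Y @ Z)"
  shows "\<exists>k. keyed (Y @ (k, e) # Z)"
proof -
  obtain k where "\<forall>a\<in>fst ` set Y. a < k" "\<forall>b\<in>fst ` set Z. k < b"
    using finite_separation[of "fst ` set Y" "fst ` set Z"] assms
    by (auto simp: keyed_append)
  then have "keyed (Y @ (k, e) # Z)"
    using assms by (auto simp: keyed_append keyed_Cons)
  then show ?thesis ..
qed

lemma keyed_exists: "\<exists>Z. keyed Z \<and> map snd Z = \<Omega>"
proof (induction \<Omega>)
  case (Cons e \<Omega>)
  then obtain Z where Z: "keyed Z" "map snd Z = \<Omega>" by blast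
  with keyed_insert[of "[]" Z e] obtain k where "keyed ((k, e) # Z)" by auto
  then show ?case using Z(2) by (metis list.simps(9) snd_conv)
qed (auto intro: exI[of _ "[]"])

lemma selectsD:
  assumes "selects \<sigma> S f" "(k, e) \<in> S"
  shows "(f e, e) \<in> S" "allows \<sigma> ContrR e \<or> f e \<le> k" "allows \<sigma> ContrL e \<or> k \<le> f e"
proof -
  have "e \<in> snd ` S" using assms(2) by (metis image_eqI snd_conv)
  then show "(f e, e) \<in> S" using assms(1) unfolding selects_def by blast
  show "allows \<sigma> ContrR e \<or> f e \<le> k" "allows \<sigma> ContrL e \<or> k \<le> f e"
    using assms unfolding selects_def by blast+
qed

lemma selectsI:
  assumes "\<And>k e. (k, e) \<in> S \<Longrightarrow> (f e, e) \<in> S"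
    and "\<And>k e. (k, e) \<in> S \<Longrightarrow> allows \<sigma> ContrR e \<or> f e \<le> k"
    and "\<And>k e. (k, e) \<in> S \<Longrightarrow> allows \<sigma> ContrL e \<or> k \<le> f e"
  shows "selects \<sigma> S f"
proof -
  have "(f e, e) \<in> S" if "e \<in> snd ` S" for e
  proof -
    from that obtain k where "(k, e) \<in> S" by force
    then show ?thesis by (rule assms(1))
  qed
  then show ?thesis unfolding selects_def using assms(2,3) by blast
qed

section \<open>Deleting copies and changing survivors\<close>

lemma selects_delete:
  assumes "selects \<sigma> S f" "k \<noteq> f x"
  shows "selects \<sigma> (S - {(k, x)}) f"
  using selectsD[OF assms(1)] assms(2) by (intro selectsI) auto

text \<open>The survivor of \<open>x\<close> remains, so the hypotheses present, and with them the
  order condition, are unaffected.\<close>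

lemma realizes_delete:
  assumes "realizes \<sigma> \<Gamma> r S f \<Omega>'" "(k, x) \<in> S" "k \<noteq> f x"
  shows "realizes \<sigma> \<Gamma> r (S - {(k, x)}) f \<Omega>'"
proof -
  have "(f x, x) \<in> S"
    using assms(1,2) selectsD(1) unfolding realizes_def by blast
  then have "x \<in> snd ` (S - {(k, x)})"
    using assms(3) by (intro image_eqI[of _ _ "(f x, x)"]) auto
  then have "snd ` (S - {(k, x)}) = snd ` S"
    using assms(2) image_insert[of snd "(k, x)" "S - {(k, x)}"] by (simp add: insert_absorb)
  then show ?thesis
    using assms selects_delete unfolding realizes_def by metis
qed

text \<open>Raising the key of \<open>x\<close> creates only inversions in which \<open>x\<close>
  comes first in \<open>\<Omega>'\<close>, and \<open>MobL\<close> lets \<open>x\<close> cross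
  leftwards in all of them.\<close>

lemma sortable_advance:
  assumes "sortable \<sigma> E f \<Omega>'" "allows \<sigma> MobL x" "f x \<le> k"
  shows "sortable \<sigma> E (f(x := k)) \<Omega>'"
  unfolding sortable_def
  by (rule sorted_wrt_mono_rel[OF _ assms(1)[unfolded sortable_def]])
    (use assms(2,3) in \<open>auto split: if_splits\<close>)

lemma sortable_retreat:
  assumes "sortable \<sigma> E f \<Omega>'" "allows \<sigma> MobR x" "k \<le> f x"
  shows "sortable \<sigma> E (f(x := k)) \<Omega>'"
  unfolding sortable_def
  by (rule sorted_wrt_mono_rel[OF _ assms(1)[unfolded sortable_def]])
    (use assms(2,3) in \<open>auto split: if_splits\<close>)

lemma sortable_cong:
  assumes "sortable \<sigma> E f \<Omega>'" "E' \<subseteq> E" "\<And>e. e \<in> E' \<Longrightarrow> f e = f' e"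
  shows "sortable \<sigma> E' f' \<Omega>'"
  unfolding sortable_def
  by (rule sorted_wrt_mono_rel[OF _ assms(1)[unfolded sortable_def]])
    (use assms(2,3) in auto)

text \<open>Serves both to undo a left move and to replace a deleted survivor: \<open>T\<close>
  differs from \<open>S\<close> only in copies of \<open>x\<close>, and \<open>p\<close> is the key
  of the new survivor.\<close>

lemma realizes_advance:
  assumes "realizes \<sigma> \<Gamma> r S f \<Omega>'" "allows \<sigma> MobL x" "f x \<le> p"
    and S: "(p, x) \<in> T" "snd ` T = snd ` S" "\<And>k e. e \<noteq> x \<Longrightarrow> (k, e) \<in> T \<longleftrightarrow> (k, e) \<in> S"
    and "\<And>k. (k, x) \<in> T \<Longrightarrow> (allows \<sigma> ContrR x \<or> p \<le> k) \<and> (allows \<sigma> ContrL x \<or> k \<le> p)"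
  shows "realizes \<sigma> \<Gamma> r T (f(x := p)) \<Omega>'"
proof -
  have sel: "selects \<sigma> S f"
    using assms(1) by (simp add: realizes_def)
  have "selects \<sigma> T (f(x := p))"
  proof (rule selectsI)
    fix k e assume ke: "(k, e) \<in> T"
    show "((f(x := p)) e, e) \<in> T" "allows \<sigma> ContrR e \<or> (f(x := p)) e \<le> k"
      "allows \<sigma> ContrL e \<or> k \<le> (f(x := p)) e"
      using ke selectsD[OF sel, of k e] assms by (cases "e = x"; simp)+
  qed
  then show ?thesis
    using assms sortable_advance unfolding realizes_def by metis
qed

lemma realizes_retreat:
  assumes "realizes \<sigma> \<Gamma> r S f \<Omega>'" "allows \<sigma> MobR x" "p \<le> f x"
    and S: "(p, x) \<in> T" "snd ` T = snd ` S" "\<And>k e. e \<noteq> x \<Longrightarrow> (k, e) \<in> T \<longleftrightarrow> (k, e) \<in> S"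
    and "\<And>k. (k, x) \<in> T \<Longrightarrow> (allows \<sigma> ContrR x \<or> p \<le> k) \<and> (allows \<sigma> ContrL x \<or> k \<le> p)"
  shows "realizes \<sigma> \<Gamma> r T (f(x := p)) \<Omega>'"
proof -
  have sel: "selects \<sigma> S f"
    using assms(1) by (simp add: realizes_def)
  have "selects \<sigma> T (f(x := p))"
  proof (rule selectsI)
    fix k e assume ke: "(k, e) \<in> T"
    show "((f(x := p)) e, e) \<in> T" "allows \<sigma> ContrR e \<or> (f(x := p)) e \<le> k"
      "allows \<sigma> ContrL e \<or> k \<le> (f(x := p)) e"
      using ke selectsD[OF sel, of k e] assms by (cases "e = x"; simp)+
  qed
  then show ?thesis
    using assms sortable_retreat unfolding realizes_def by metis
qed

text \<open>Undoing a move changes one key from \<open>k'\<close> to \<open>k\<close>, possibly past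
  other copies of the same hypothesis, so the survivor \<open>q\<close> may have to be replaced.
  \<open>a\<close> and \<open>b\<close> stand for right and left contraction. With both,
  \<open>q\<close> is kept unless it is the moved copy; without \<open>a\<close> the leftmost copy
  is forced, without \<open>b\<close> the rightmost; without either there is no other copy. The
  bound \<open>p \<le> q\<close> is the direction that right mobility permits.\<close>

lemma retreat_choice:
  fixes K :: "rat set"
  assumes "finite K" "k < k'" "k' \<notin> K" "q \<in> insert k' K"
    and "\<And>j. j \<in> insert k' K \<Longrightarrow> (a \<or> q \<le> j) \<and> (b \<or> j \<le> q)"
  shows "\<exists>p\<in>insert k K. p \<le> q \<and> (\<forall>j\<in>insert k K. (a \<or> p \<le> j) \<and> (b \<or> j \<le> p))"
proof (cases b)
  case False
  have *: "j \<le> q" if "j \<in> insert k K" for j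
    using that assms False by force
  have "K = {}" if "\<not> a"
    using that False assms by (metis antisym ex_in_conv insertCI)
  moreover have "Max (insert k K) \<in> insert k K" using assms(1) by (intro Max_in) auto
  ultimately show ?thesis using * assms(1) False
    by (intro bexI[of _ "Max (insert k K)"]) (auto intro: Max_ge)
next
  case b: True
  show ?thesis
  proof (cases a)
    case True
    then show ?thesis using b assms by (cases "q = k'") (auto intro: less_imp_le)
  next
    case False
    have "Min (insert k K) \<in> insert k K" using assms(1) by (intro Min_in) auto
    moreover have "Min (insert k K) \<le> q"
    proof (cases "q = k'")
      case True
      then show ?thesis using assms(1,2) Min_le[of "insert k K" k] by (meson finite_insert insertI1 less_imp_le order_trans)
    qed (use assms(1,4) in \<open>auto intro: Min_le\<close>)
    ultimately show ?thesis using b assms(1)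
      by (intro bexI[of _ "Min (insert k K)"]) (auto intro: Min_le)
  qed
qed

lemma advance_choice:
  fixes K :: "rat set"
  assumes "finite K" "k' < k" "k' \<notin> K" "q \<in> insert k' K"
    and "\<And>j. j \<in> insert k' K \<Longrightarrow> (a \<or> q \<le> j) \<and> (b \<or> j \<le> q)"
  shows "\<exists>p\<in>insert k K. q \<le> p \<and> (\<forall>j\<in>insert k K. (a \<or> p \<le> j) \<and> (b \<or> j \<le> p))"
proof (cases a)
  case False
  have *: "q \<le> j" if "j \<in> insert k K" for j
    using that assms False by force
  have "K = {}" if "\<not> b"
    using that False assms by (metis antisym ex_in_conv insertCI)
  moreover have "Min (insert k K) \<in> insert k K" using assms(1) by (intro Min_in) auto
  ultimately show ?thesis using * assms(1) False
    by (intro bexI[of _ "Min (insert k K)"]) (auto intro: Min_le)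
next
  case a: True
  show ?thesis
  proof (cases b)
    case True
    then show ?thesis using a assms by (cases "q = k'") (auto intro: less_imp_le)
  next
    case False
    have "Max (insert k K) \<in> insert k K" using assms(1) by (intro Max_in) auto
    moreover have "q \<le> Max (insert k K)"
    proof (cases "q = k'")
      case True
      then show ?thesis using assms(1,2) Max_ge[of "insert k K" k] by (meson finite_insert insertI1 less_imp_le order_trans)
    qed (use assms(1,4) in \<open>auto intro: Max_ge\<close>)
    ultimately show ?thesis using a assms(1)
      by (intro bexI[of _ "Max (insert k K)"]) (auto intro: Max_ge)
  qed
qed

section \<open>Selections along the reverse of a single reduction step\<close>

lemma realizes_unmove:
  assumes "realizes \<sigma> \<Gamma> r (insert (k', x) S) f \<Omega>'" "finite S" "(k', x) \<notin> S"
    and "k < k' \<and> allows \<sigma> MobR x \<or> k' < k \<and> allows \<sigma> MobL x"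
  shows "\<exists>f. realizes \<sigma> \<Gamma> r (insert (k, x) S) f \<Omega>'"
proof -
  define K where "K = {j. (j, x) \<in> S}"
  have "K \<subseteq> fst ` S" by (force simp: K_def)
  then have K: "finite K" "k' \<notin> K"
    using assms(2,3) finite_subset by (auto simp: K_def)
  have sel: "f x \<in> insert k' K"
    "\<And>j. j \<in> insert k' K \<Longrightarrow>
      (allows \<sigma> ContrR x \<or> f x \<le> j) \<and> (allows \<sigma> ContrL x \<or> j \<le> f x)"
    using selectsD[of \<sigma> "insert (k', x) S" f _ x] assms(1) unfolding realizes_def K_def by auto
  from assms(4) show ?thesis
  proof
    assume *: "k < k' \<and> allows \<sigma> MobR x"
    with retreat_choice[OF K(1) _ K(2) sel] obtain p where "p\<in>insert k K" "p \<le> f x"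
      "\<forall>j\<in>insert k K. (allows \<sigma> ContrR x \<or> p \<le> j) \<and> (allows \<sigma> ContrL x \<or> j \<le> p)"
      by blast
    then have "realizes \<sigma> \<Gamma> r (insert (k, x) S) (f(x := p)) \<Omega>'"
      using * by (intro realizes_retreat[OF assms(1)]) (auto simp: K_def)
    then show ?thesis by blast
  next
    assume *: "k' < k \<and> allows \<sigma> MobL x"
    with advance_choice[OF K(1) _ K(2) sel] obtain p where "p\<in>insert k K" "f x \<le> p"
      "\<forall>j\<in>insert k K. (allows \<sigma> ContrR x \<or> p \<le> j) \<and> (allows \<sigma> ContrL x \<or> j \<le> p)"
      by blast
    then have "realizes \<sigma> \<Gamma> r (insert (k, x) S) (f(x := p)) \<Omega>'"
      using * by (intro realizes_advance[OF assms(1)]) (auto simp: K_def)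
    then show ?thesis by blast
  qed
qed

text \<open>The new copy lies beyond the retained one at \<open>k'\<close>. In that direction the
  bound for \<open>k'\<close> passes on to it; in the other the contraction itself makes the bound
  void.\<close>

lemma realizes_uncontract:
  assumes "realizes \<sigma> \<Gamma> r S f \<Omega>'" "(k', x) \<in> S"
    and "k' < k \<and> allows \<sigma> ContrL x \<or> k < k' \<and> allows \<sigma> ContrR x"
  shows "realizes \<sigma> \<Gamma> r (insert (k, x) S) f \<Omega>'"
proof -
  have "snd ` insert (k, x) S = snd ` S"
    using assms(2) by force
  moreover have sel: "selects \<sigma> S f"
    using assms(1) by (simp add: realizes_def)
  have "selects \<sigma> (insert (k, x) S) f"
  proof (rule selectsI)
    fix j e assume je: "(j, e) \<in> insert (k, x) S"
    show "(f e, e) \<in> insert (k, x) S" "allows \<sigma> ContrR e \<or> f e \<le> j"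
      "allows \<sigma> ContrL e \<or> j \<le> f e"
      using je selectsD[OF sel, of j e] selectsD[OF sel assms(2)] assms(3)
      by (cases "(j, e) = (k, x)"; auto)+
  qed
  ultimately show ?thesis
    using assms(1) unfolding realizes_def by metis
qed

lemma realizes_unweaken:
  assumes "realizes \<sigma> \<Gamma> r (insert (k, x) S) f \<Omega>'" "x \<notin> snd ` S"
    and "allows \<sigma> Weak x" "mode_of (snd x) \<ge> r" "x \<in> \<Gamma>"
  shows "realizes \<sigma> \<Gamma> r S f \<Omega>'"
proof -
  have sel: "selects \<sigma> (insert (k, x) S) f"
    using assms(1) by (simp add: realizes_def)
  have "selects \<sigma> S f"
  proof (rule selectsI)
    fix j e assume "(j, e) \<in> S"
    moreover from this have "e \<noteq> x" using assms(2) by force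
    ultimately show "(f e, e) \<in> S" "allows \<sigma> ContrR e \<or> f e \<le> j"
      "allows \<sigma> ContrL e \<or> j \<le> f e"
      using selectsD[OF sel, of j e] by auto
  qed
  moreover have "sortable \<sigma> (snd ` S) f \<Omega>'"
    using assms(1) sortable_cong unfolding realizes_def by (metis image_mono subset_insertI)
  ultimately show ?thesis
    using assms unfolding realizes_def by auto
qed

lemma realizes_id:
  assumes "keyed Z" "normal_ctx (map snd Z)"
  shows "\<exists>f. realizes \<sigma> \<Gamma> r (set Z) f (map snd Z)"
proof -
  have inj: "inj_on snd (set Z)"
    using assms(2) unfolding normal_ctx_def by (metis distinct_map)
  \<comment> \<open>In a normal context every hypothesis has a single copy, so the choice is its
    unique key.\<close>
  define f where "f e = (SOME k. (k, e) \<in> set Z)" for e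
  have f: "f e = k" if "(k, e) \<in> set Z" for k e
    using inj that someI[of "\<lambda>k. (k, e) \<in> set Z", OF that] unfolding f_def inj_on_def by fastforce
  have "sortable \<sigma> (snd ` set Z) f (map snd Z)"
    using assms(1) f unfolding sortable_def keyed_def sorted_wrt_map
    by (elim sorted_wrt_mono_rel[rotated]) (metis less_asym prod.collapse)
  then have "realizes \<sigma> \<Gamma> r (set Z) f (map snd Z)"
    using assms(2) f unfolding realizes_def selects_def by auto
  then show ?thesis by blast
qed

section \<open>From reductions to selections\<close>

lemma map_snd_splits:
  "map snd Z = L @ M \<longleftrightarrow> (\<exists>ZL ZM. Z = ZL @ ZM \<and> map snd ZL = L \<and> map snd ZM = M)"
  "map snd Z = x # M \<longleftrightarrow> (\<exists>k ZM. Z = (k, x) # ZM \<and> map snd ZM = M)"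
  by (auto simp: map_eq_append_conv map_eq_Cons_conv)

text \<open>Each rule is traversed from the context after the step to the one before it.
  \<open>Z\<close> is arbitrary in the induction because the context after the step reuses the keys
  of \<open>Z\<close>, with a fresh one for an added or moved hypothesis.\<close>

lemma ctx_red_realizes:
  assumes "ctx_red \<sigma> \<Gamma> r \<Omega> \<Omega>'" "keyed Z" "map snd Z = \<Omega>"
  shows "\<exists>f. realizes \<sigma> \<Gamma> r (set Z) f \<Omega>'"
  using assms
proof (induction arbitrary: Z rule: ctx_red.induct)
  case (r_Weak L x A R \<Omega>')
  then obtain ZL ZR where Z: "Z = ZL @ ZR" "map snd ZL = L" "map snd ZR = R"
    by (auto simp: map_snd_splits)
  obtain k where k: "keyed (ZL @ (k, x, A) # ZR)"
    using keyed_insert[of ZL ZR "(x, A)"] r_Weak.prems(1) Z(1) by auto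
  with r_Weak.IH[of "ZL @ (k, x, A) # ZR"] Z obtain f where
    "realizes \<sigma> \<Gamma> r (insert (k, x, A) (set Z)) f \<Omega>'" by auto
  moreover have "(x, A) \<notin> snd ` set Z"
    using r_Weak.hyps Z by (force simp: vars_def)
  ultimately show ?case
    using realizes_unweaken r_Weak.hyps by (metis snd_conv)
next
  case (r_ContrL L x A M R \<Omega>')
  then obtain ZL k ZM k' ZR where Z: "Z = ZL @ (k, x, A) # ZM @ (k', x, A) # ZR"
    "map snd ZL = L" "map snd ZM = M" "map snd ZR = R"
    by (auto simp: map_snd_splits)
  obtain f where f: "realizes \<sigma> \<Gamma> r (set (ZL @ (k, x, A) # ZM @ ZR)) f \<Omega>'"
    using r_ContrL.IH[of "ZL @ (k, x, A) # ZM @ ZR"] r_ContrL.prems Z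
    by (auto simp: keyed_append keyed_Cons)
  have "k < k'" using r_ContrL.prems Z(1) by (simp add: keyed_append keyed_Cons)
  with realizes_uncontract[OF f, of k "(x, A)" k'] r_ContrL.hyps Z(1) show ?case
    by (auto simp: insert_commute)
next
  case (r_ContrR L M x A R \<Omega>')
  then obtain ZL k ZM k' ZR where Z: "Z = ZL @ (k, x, A) # ZM @ (k', x, A) # ZR"
    "map snd ZL = L" "map snd ZM = M" "map snd ZR = R"
    by (auto simp: map_snd_splits)
  obtain f where f: "realizes \<sigma> \<Gamma> r (set (ZL @ ZM @ (k', x, A) # ZR)) f \<Omega>'"
    using r_ContrR.IH[of "ZL @ ZM @ (k', x, A) # ZR"] r_ContrR.prems Z
    by (auto simp: keyed_append keyed_Cons)
  have "k < k'" using r_ContrR.prems Z(1) by (simp add: keyed_append keyed_Cons)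
  with realizes_uncontract[OF f, of k' "(x, A)" k] r_ContrR.hyps Z(1) show ?case
    by auto
next
  case (r_MobL L x A M R \<Omega>')
  then obtain ZL k ZM ZR where Z: "Z = ZL @ ZM @ (k, x, A) # ZR"
    "map snd ZL = L" "map snd ZM = M" "map snd ZR = R"
    by (auto simp: map_snd_splits)
  \<comment> \<open>Old and new place of the moved hypothesis are keyed in one list only to compare
    them; each context contains just one of the two.\<close>
  obtain k' where k': "keyed (ZL @ (k', x, A) # ZM @ (k, x, A) # ZR)"
    using keyed_insert[of ZL "ZM @ (k, x, A) # ZR"] r_MobL.prems Z(1) by auto
  then have k: "k' < k" "(k', x, A) \<notin> set (ZL @ ZM @ ZR)"
    by (force simp: keyed_append keyed_Cons)+
  obtain f where f: "realizes \<sigma> \<Gamma> r (insert (k', x, A) (set (ZL @ ZM @ ZR))) f \<Omega>'"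
    using r_MobL.IH[of "ZL @ (k', x, A) # ZM @ ZR"] k' Z
    by (auto simp: keyed_append keyed_Cons)
  then show ?case
    using realizes_unmove[OF f, of k] k r_MobL.hyps Z(1) by auto
next
  case (r_MobR L M x A R \<Omega>')
  then obtain ZL k ZM ZR where Z: "Z = ZL @ (k, x, A) # ZM @ ZR"
    "map snd ZL = L" "map snd ZM = M" "map snd ZR = R"
    by (auto simp: map_snd_splits)
  obtain k' where k': "keyed ((ZL @ (k, x, A) # ZM) @ (k', x, A) # ZR)"
    using keyed_insert[of "ZL @ (k, x, A) # ZM" ZR] r_MobR.prems Z(1) by auto
  then have k: "k < k'" "(k', x, A) \<notin> set (ZL @ ZM @ ZR)"
    by (force simp: keyed_append keyed_Cons)+
  obtain f where f: "realizes \<sigma> \<Gamma> r (insert (k', x, A) (set (ZL @ ZM @ ZR))) f \<Omega>'"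
    using r_MobR.IH[of "ZL @ ZM @ (k', x, A) # ZR"] k' Z
    by (auto simp: keyed_append keyed_Cons)
  then show ?case
    using realizes_unmove[OF f, of k] k r_MobR.hyps Z(1) by auto
next
  case (r_id \<Omega>)
  then show ?case using realizes_id by blast
qed

section \<open>From selections back to reductions\<close>

lemma ctx_red_weaken_into:
  assumes "normal_ctx (\<Theta> @ \<Omega>)"
    and "\<And>e. e \<in> set \<Omega> \<Longrightarrow> \<not> P e \<Longrightarrow> allows \<sigma> Weak e \<and> mode_of (snd e) \<ge> r \<and> e \<in> \<Gamma>"
  shows "ctx_red \<sigma> \<Gamma> r (\<Theta> @ filter P \<Omega>) (\<Theta> @ \<Omega>)"
  using assms
proof (induction \<Omega> arbitrary: \<Theta>)
  case Nil
  then show ?case by (simp add: r_id)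
next
  case (Cons e \<Omega>)
  have IH: "ctx_red \<sigma> \<Gamma> r ((\<Theta> @ [e]) @ filter P \<Omega>) ((\<Theta> @ [e]) @ \<Omega>)"
    by (rule Cons.IH) (use Cons.prems in auto)
  show ?case
  proof (cases "P e")
    case False
    obtain x A where e: "e = (x, A)" by force
    \<comment> \<open>The fresh variable demanded by weakening comes from normality of
      \<open>\<Theta> @ e # \<Omega>\<close>, of which the current context is a subsequence.\<close>
    have "ctx_red \<sigma> \<Gamma> r (\<Theta> @ filter P \<Omega>) (\<Theta> @ e # \<Omega>)"
      by (rule r_Weak[where x = x and A = A])
        (use IH Cons.prems(2)[of e] False Cons.prems(1) in \<open>auto simp: e normal_ctx_def vars_def\<close>)
    then show ?thesis using False by simp
  qed (use IH in simp)
qed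

lemma ctx_red_swap:
  assumes "ctx_red \<sigma> \<Gamma> r (L @ e # d # R) \<Omega>'" "allows \<sigma> MobR d \<or> allows \<sigma> MobL e"
  shows "ctx_red \<sigma> \<Gamma> r (L @ d # e # R) \<Omega>'"
  using assms(2)
proof
  assume "allows \<sigma> MobR d"
  then show ?thesis
    using assms(1) r_MobR[of \<sigma> \<Gamma> r L "[e]" "fst d" "snd d" R \<Omega>'] by simp
next
  assume "allows \<sigma> MobL e"
  then show ?thesis
    using assms(1) r_MobL[of \<sigma> \<Gamma> r L "fst e" "snd e" "[d]" R \<Omega>'] by simp
qed

text \<open>Which partner is mobile may vary with \<open>d\<close>, so in general no single move
  carries \<open>e\<close> across \<open>M\<close>; adjacent exchanges do.\<close>

lemma ctx_red_bubble:
  assumes "ctx_red \<sigma> \<Gamma> r (L @ e # M @ R) \<Omega>'"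
    and "\<And>d. d \<in> set M \<Longrightarrow> allows \<sigma> MobR d \<or> allows \<sigma> MobL e"
  shows "ctx_red \<sigma> \<Gamma> r (L @ M @ e # R) \<Omega>'"
  using assms
proof (induction M arbitrary: R rule: rev_induct)
  case (snoc d M)
  then have "ctx_red \<sigma> \<Gamma> r (L @ M @ e # d # R) \<Omega>'" by simp
  then show ?case using ctx_red_swap[of \<sigma> \<Gamma> r "L @ M" e d R] snoc.prems(2)[of d] by simp
qed simp

text \<open>Selection sort: the head \<open>e\<close> of the target is brought forward,
  \<open>L\<close> being already in place. The hypotheses it passes have smaller keys but come later
  in \<open>\<Theta>\<close>, so only inverted pairs cross and the pairwise condition
  suffices.\<close>

lemma ctx_red_sort:
  assumes "ctx_red \<sigma> \<Gamma> r (L @ \<Theta>) \<Omega>'" "set \<Omega> = set \<Theta>" "distinct \<Omega>" "distinct \<Theta>"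
    and "sorted_wrt (\<lambda>a b. f a < f b) \<Omega>" "sortable \<sigma> (set \<Theta>) f \<Theta>"
  shows "ctx_red \<sigma> \<Gamma> r (L @ \<Omega>) \<Omega>'"
  using assms
proof (induction \<Theta> arbitrary: L \<Omega>)
  case (Cons e \<Theta>)
  then have "e \<in> set \<Omega>" by simp
  then obtain M R where \<Omega>: "\<Omega> = M @ e # R" by (meson split_list)
  have "sortable \<sigma> (set \<Theta>) f \<Theta>"
    using Cons.prems(6) sortable_cong[of \<sigma> "set (e # \<Theta>)" f \<Theta> "set \<Theta>" f]
    by (auto simp: sortable_def)
  moreover have "set (M @ R) = set \<Theta>"
    using Cons.prems(2-4) \<Omega> by auto
  ultimately have "ctx_red \<sigma> \<Gamma> r ((L @ [e]) @ M @ R) \<Omega>'"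
    by (intro Cons.IH[of "L @ [e]" "M @ R"]) (use Cons.prems \<Omega> in \<open>auto simp: sorted_wrt_append\<close>)
  moreover have "allows \<sigma> MobR d \<or> allows \<sigma> MobL e" if "d \<in> set M" for d
  proof -
    have "d \<in> set \<Theta>" "f d < f e"
      using that Cons.prems(2-5) \<Omega> by (auto simp: sorted_wrt_append)
    then show ?thesis using Cons.prems(6) by (auto simp: sortable_def)
  qed
  ultimately show ?case
    using ctx_red_bubble[of \<sigma> \<Gamma> r L e M R] \<Omega> by simp
qed simp

text \<open>Induction on length: a copy that is not a survivor is contracted against its survivor,
  on whichever side that lies.\<close>

lemma realizes_ctx_red:
  assumes "realizes \<sigma> \<Gamma> r (set Z) f \<Omega>'" "keyed Z"
  shows "ctx_red \<sigma> \<Gamma> r (map snd Z) \<Omega>'"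
  using assms
proof (induction Z rule: length_induct)
  case (1 Z)
  have sel: "selects \<sigma> (set Z) f" using 1(2) by (simp add: realizes_def)
  show ?case
  proof (cases "\<forall>z\<in>set Z. fst z = f (snd z)")
    case True
    \<comment> \<open>With only survivors left, \<open>f\<close> agrees with the keys, and their
      strict increase also makes the hypotheses distinct.\<close>
    have srt: "sorted_wrt (\<lambda>a b. f a < f b) (map snd Z)"
      unfolding sorted_wrt_map
      by (rule sorted_wrt_mono_rel[OF _ 1(3)[unfolded keyed_def]]) (use True in simp)
    have dist: "distinct (map snd Z)"
      using strict_sorted_iff[of "map f (map snd Z)"] srt
      unfolding sorted_wrt_map by (metis distinct_map)
    define \<Theta> where "\<Theta> = filter (\<lambda>e. e \<in> snd ` set Z) \<Omega>'"
    have r: "normal_ctx \<Omega>'" "snd ` set Z \<subseteq> set \<Omega>'" "sortable \<sigma> (snd ` set Z) f \<Omega>'"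
      "\<forall>e\<in>set \<Omega>' - snd ` set Z. allows \<sigma> Weak e \<and> mode_of (snd e) \<ge> r \<and> e \<in> \<Gamma>"
      using 1(2) by (simp_all add: realizes_def)
    have "ctx_red \<sigma> \<Gamma> r ([] @ \<Theta>) ([] @ \<Omega>')"
      unfolding \<Theta>_def by (rule ctx_red_weaken_into) (use r in auto)
    moreover have "set (map snd Z) = set \<Theta>" using r(2) by (auto simp: \<Theta>_def)
    moreover have "distinct \<Theta>"
      using r(1) by (auto simp: \<Theta>_def normal_ctx_def distinct_map)
    moreover have "sortable \<sigma> (set \<Theta>) f \<Theta>"
      using sortable_cong[OF r(3), of "set \<Theta>" f] sorted_wrt_filter
      unfolding \<Theta>_def sortable_def by auto
    ultimately show ?thesis
      using ctx_red_sort[of \<sigma> \<Gamma> r "[]" \<Theta> \<Omega>' "map snd Z" f] srt dist by simp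
  next
    case False
    then obtain k x A where k: "(k, x, A) \<in> set Z" "k \<noteq> f (x, A)" by force
    have f: "(f (x, A), x, A) \<in> set Z" using selectsD[OF sel k(1)] by simp
    show ?thesis
    proof (cases "f (x, A) < k")
      case True
      obtain Y ZR where Y: "Z = Y @ (k, x, A) # ZR"
        using k(1) by (meson split_list)
      then have "(f (x, A), x, A) \<in> set Y"
        using f True 1(3) by (auto simp: keyed_append keyed_Cons)
      then obtain ZL ZM where Y': "Y = ZL @ (f (x, A), x, A) # ZM"
        by (meson split_list)
      let ?Z = "ZL @ (f (x, A), x, A) # ZM @ ZR"
      have "set ?Z = set Z - {(k, x, A)}"
        using 1(3) unfolding Y Y' by (auto simp: keyed_append keyed_Cons)
      then have "realizes \<sigma> \<Gamma> r (set ?Z) f \<Omega>'"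
        using realizes_delete[OF 1(2) k] by simp
      moreover have "keyed ?Z" "length ?Z < length Z"
        using 1(3) unfolding Y Y' by (auto simp: keyed_append keyed_Cons)
      ultimately have "ctx_red \<sigma> \<Gamma> r (map snd ?Z) \<Omega>'" using 1(1) by blast
      then show ?thesis
        using r_ContrL[of \<sigma> \<Gamma> r "map snd ZL" x A "map snd ZM" "map snd ZR" \<Omega>']
          selectsD(3)[OF sel k(1)] True unfolding Y Y' by auto
    next
      case False
      then have k': "k < f (x, A)" using k(2) by simp
      obtain Y ZL where Y: "Z = ZL @ (k, x, A) # Y"
        using k(1) by (meson split_list)
      then have "(f (x, A), x, A) \<in> set Y"
        using f k' 1(3) by (auto simp: keyed_append keyed_Cons)
      then obtain ZM ZR where Y': "Y = ZM @ (f (x, A), x, A) # ZR"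
        by (meson split_list)
      let ?Z = "ZL @ ZM @ (f (x, A), x, A) # ZR"
      have "set ?Z = set Z - {(k, x, A)}"
        using 1(3) unfolding Y Y' by (force simp: keyed_append keyed_Cons)
      then have "realizes \<sigma> \<Gamma> r (set ?Z) f \<Omega>'"
        using realizes_delete[OF 1(2) k] by simp
      moreover have "keyed ?Z" "length ?Z < length Z"
        using 1(3) unfolding Y Y' by (auto simp: keyed_append keyed_Cons)
      ultimately have "ctx_red \<sigma> \<Gamma> r (map snd ?Z) \<Omega>'" using 1(1) by blast
      then show ?thesis
        using r_ContrR[of \<sigma> \<Gamma> r "map snd ZL" "map snd ZM" x A "map snd ZR" \<Omega>']
          selectsD(2)[OF sel k(1)] k' unfolding Y Y' by auto
    qed
  qed
qed

section \<open>Contracting and weakening ahead of a reduction\<close>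

text \<open>The two keys differ, so at most one of the copies survives; the selection conditions
  then license a contraction that removes one that does not.\<close>

lemma ctx_red_contract_pair:
  assumes "ctx_red \<sigma> \<Gamma> r (L @ e # M @ e # R) \<Omega>'"
  shows "allows \<sigma> ContrL e \<and> ctx_red \<sigma> \<Gamma> r (L @ e # M @ R) \<Omega>' \<or>
    allows \<sigma> ContrR e \<and> ctx_red \<sigma> \<Gamma> r (L @ M @ e # R) \<Omega>'"
proof -
  obtain Z where Z: "keyed Z" "map snd Z = L @ e # M @ e # R"
    using keyed_exists by blast
  then obtain ZL k ZM k' ZR where Z': "Z = ZL @ (k, e) # ZM @ (k', e) # ZR"
    "map snd ZL = L" "map snd ZM = M" "map snd ZR = R"
    by (auto simp: map_snd_splits)
  obtain f where f: "realizes \<sigma> \<Gamma> r (set Z) f \<Omega>'"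
    using ctx_red_realizes[OF assms Z] by blast
  then have sel: "selects \<sigma> (set Z) f" by (simp add: realizes_def)
  have kk: "k < k'" "(k, e) \<in> set Z" "(k', e) \<in> set Z"
    using Z(1) Z'(1) by (auto simp: keyed_append keyed_Cons)
  have L: "ctx_red \<sigma> \<Gamma> r (L @ M @ e # R) \<Omega>'" if "k \<noteq> f e"
  proof -
    let ?Z = "ZL @ ZM @ (k', e) # ZR"
    have "set ?Z = set Z - {(k, e)}" "keyed ?Z"
      using Z(1) unfolding Z'(1) by (force simp: keyed_append keyed_Cons)+
    then show ?thesis
      using realizes_ctx_red[of \<sigma> \<Gamma> r ?Z f] realizes_delete[OF f kk(2) that] Z' by simp
  qed
  have R: "ctx_red \<sigma> \<Gamma> r (L @ e # M @ R) \<Omega>'" if "k' \<noteq> f e"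
  proof -
    let ?Z = "ZL @ (k, e) # ZM @ ZR"
    have "set ?Z = set Z - {(k', e)}" "keyed ?Z"
      using Z(1) unfolding Z'(1) by (force simp: keyed_append keyed_Cons)+
    then show ?thesis
      using realizes_ctx_red[of \<sigma> \<Gamma> r ?Z f] realizes_delete[OF f kk(3) that] Z' by simp
  qed
  show ?thesis
  proof (cases "k' \<noteq> f e \<and> allows \<sigma> ContrL e")
    case False
    \<comment> \<open>Either the right copy survives or left contraction is missing. Both put the
      survivor at or beyond \<open>k'\<close>, hence strictly right of \<open>k\<close>, which
      forces right contraction to be available.\<close>
    then have "k' \<le> f e" using selectsD(3)[OF sel kk(3)] by auto
    then show ?thesis using L selectsD(2)[OF sel kk(2)] kk(1) by auto
  qed (use R in simp)
qed

text \<open>\<open>k\<close> is the key of a deleted survivor, \<open>K\<close> those of the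
  remaining copies. The last conjunct ties the direction of the replacement to a contraction: going
  right will need \<open>MobL\<close>, which comes with \<open>ContrL\<close>, and symmetrically.
  Were both contractions missing, every other key would equal \<open>k\<close>.\<close>

lemma reselect_choice:
  fixes K :: "rat set"
  assumes "finite K" "K \<noteq> {}" "k \<notin> K"
    and "\<And>j. j \<in> K \<Longrightarrow> (a \<or> k \<le> j) \<and> (b \<or> j \<le> k)"
  shows "\<exists>p\<in>K. (\<forall>j\<in>K. (a \<or> p \<le> j) \<and> (b \<or> j \<le> p)) \<and> (k \<le> p \<and> b \<or> p \<le> k \<and> a)"
proof -
  have "Min K \<in> K" "Max K \<in> K" using assms by simp_all
  then show ?thesis
    using assms Min_le[OF assms(1)] Max_ge[OF assms(1)]
    by (cases a; cases b) (metis antisym nle_le)+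
qed

text \<open>Without another copy of \<open>e\<close> this is the weakening step itself. With one,
  the freshness condition blocks that step, and if the deleted copy was the survivor another takes
  over.\<close>

lemma ctx_red_drop:
  assumes "adjoint_modes \<sigma>"
    and "ctx_red \<sigma> \<Gamma> r (L @ e # R) \<Omega>'"
    and "e \<in> \<Gamma>" "mode_of (snd e) \<ge> r" "allows \<sigma> Weak e" "single_valued \<Gamma>"
    and "set L \<union> set R \<subseteq> \<Gamma>"
  shows "ctx_red \<sigma> \<Gamma> r (L @ R) \<Omega>'"
proof (cases "e \<in> set (L @ R)")
  case False
  obtain x A where e: "e = (x, A)" by force
  \<comment> \<open>Absence of the hypothesis becomes absence of its variable because
    \<open>\<Gamma>\<close> is single-valued.\<close>
  have "x \<notin> vars (L @ R)"
    using False assms(3,6,7) unfolding e vars_def by (auto dest: single_valuedD)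
  then show ?thesis
    using assms r_Weak[of \<sigma> \<Gamma> r L x A R \<Omega>'] e by simp
next
  case True
  obtain Z where Z: "keyed Z" "map snd Z = L @ e # R"
    using keyed_exists by blast
  then obtain ZL k ZR where Z': "Z = ZL @ (k, e) # ZR" "map snd ZL = L" "map snd ZR = R"
    by (auto simp: map_snd_splits)
  obtain f where f: "realizes \<sigma> \<Gamma> r (set Z) f \<Omega>'"
    using ctx_red_realizes[OF assms(2) Z] by blast
  then have sel: "selects \<sigma> (set Z) f" by (simp add: realizes_def)
  let ?Z = "ZL @ ZR"
  have Zd: "set ?Z = set Z - {(k, e)}" "keyed ?Z"
    using Z(1) unfolding Z'(1) by (force simp: keyed_append keyed_Cons)+
  have ke: "(k, e) \<in> set Z" using Z' by simp
  have "\<exists>f. realizes \<sigma> \<Gamma> r (set ?Z) f \<Omega>'"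
  proof (cases "k = f e")
    case False
    then show ?thesis using realizes_delete[OF f ke] Zd by auto
  next
    case k: True
    define K where "K = {j. (j, e) \<in> set ?Z}"
    have "K \<subseteq> fst ` set ?Z" by (force simp: K_def)
    then have "finite K" using finite_subset by auto
    moreover have "K \<noteq> {}"
    proof -
      have "e \<in> snd ` set ?Z" using True Z'(2,3) by auto
      then show ?thesis by (force simp: K_def)
    qed
    moreover have "k \<notin> K" using Zd by (simp add: K_def)
    moreover have "(allows \<sigma> ContrR e \<or> k \<le> j) \<and> (allows \<sigma> ContrL e \<or> j \<le> k)" if "j \<in> K" for j
      using selectsD[OF sel, of j e] that Zd(1) unfolding K_def k by auto
    ultimately obtain p where p: "p \<in> K"
      "\<forall>j\<in>K. (allows \<sigma> ContrR e \<or> p \<le> j) \<and> (allows \<sigma> ContrL e \<or> j \<le> p)"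
      "k \<le> p \<and> allows \<sigma> ContrL e \<or> p \<le> k \<and> allows \<sigma> ContrR e"
      using reselect_choice[of K k "allows \<sigma> ContrR e" "allows \<sigma> ContrL e"] by blast
    have snd: "snd ` set ?Z = snd ` set Z"
      using True Z' by auto
    \<comment> \<open>The closure conditions on modes enter here: \<open>e\<close> can be weakened,
      so contraction in a direction brings mobility in that direction, and the new survivor can
      travel to the place of the old one.\<close>
    have mob: "allows \<sigma> ContrL e \<longrightarrow> allows \<sigma> MobL e" "allows \<sigma> ContrR e \<longrightarrow> allows \<sigma> MobR e"
      using assms(1,5) by (auto simp: adjoint_modes_def)
    from p(3) have "realizes \<sigma> \<Gamma> r (set ?Z) (f(e := p)) \<Omega>'"
    proof
      assume "k \<le> p \<and> allows \<sigma> ContrL e"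
      then show ?thesis
        using p mob snd k Zd(1)
        by (intro realizes_advance[OF f]) (auto simp: K_def simp del: set_append)
    next
      assume "p \<le> k \<and> allows \<sigma> ContrR e"
      then show ?thesis
        using p mob snd k Zd(1)
        by (intro realizes_retreat[OF f]) (auto simp: K_def simp del: set_append)
    qed
    then show ?thesis by blast
  qed
  then show ?thesis using realizes_ctx_red[OF _ Zd(2)] Z' by auto
qed

section \<open>Normalising part of a context by contraction\<close>

lemma ctx_red_set_subset:
  assumes "ctx_red \<sigma> \<Gamma> r \<Omega> \<Omega>'"
  shows "set \<Omega> \<subseteq> set \<Omega>'" "normal_ctx \<Omega>'"
  using assms by (induction rule: ctx_red.induct) auto

lemma ctx_red_contractL:
  assumes "ctx_red \<sigma> \<Gamma> r (L @ e # M @ R) \<Omega>'" "allows \<sigma> ContrL e"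
  shows "ctx_red \<sigma> \<Gamma> r (L @ e # M @ e # R) \<Omega>'"
  using assms r_ContrL[of \<sigma> \<Gamma> r L "fst e" "snd e" M R \<Omega>'] by simp

lemma ctx_red_contractR:
  assumes "ctx_red \<sigma> \<Gamma> r (L @ M @ e # R) \<Omega>'" "allows \<sigma> ContrR e"
  shows "ctx_red \<sigma> \<Gamma> r (L @ e # M @ e # R) \<Omega>'"
  using assms r_ContrR[of \<sigma> \<Gamma> r L M "fst e" "snd e" R \<Omega>'] by simp

text \<open>
  \<open>X\<close> stands for the bound hypotheses that an elimination rule has in the place of
  \<open>M\<close>.  The last two reductions only contract, so they work for all hypotheses and modes.
\<close>

definition context_split ::
  "('m::preorder \<Rightarrow> structural set) \<Rightarrow> ('v, 'm, 'p) hyps \<Rightarrow> 'm \<Rightarrow> ('v, 'm, 'p) octx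
    \<Rightarrow> ('v, 'm, 'p) octx \<Rightarrow> ('v, 'm, 'p) octx \<Rightarrow> ('v, 'm, 'p) octx
    \<Rightarrow> ('v, 'm, 'p) octx \<Rightarrow> ('v, 'm, 'p) octx \<Rightarrow> ('v, 'm, 'p) octx \<Rightarrow> bool" where
  "context_split \<sigma> \<Gamma> r \<Omega>' L M R L' M' R' \<longleftrightarrow>
     normal_ctx (L' @ R') \<and> normal_ctx M' \<and> ctx_red \<sigma> \<Gamma> r (L' @ M' @ R') \<Omega>' \<and>
     set L' \<subseteq> set L \<and> set R' \<subseteq> set R \<and>
     (\<forall>\<Gamma> r. ctx_red \<sigma> \<Gamma> r M M') \<and>
     (\<forall>\<Gamma> r X. normal_ctx (L' @ X @ R') \<longrightarrow> ctx_red \<sigma> \<Gamma> r (L @ X @ R) (L' @ X @ R'))"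

text \<open>A repetition inside \<open>M\<close>, or inside \<open>L\<close> and \<open>R\<close>
  together, is contracted; one between \<open>M\<close> and its surroundings is left to the outer
  reduction. Each contraction shortens the context.\<close>

lemma ctx_red_split:
  assumes "ctx_red \<sigma> \<Gamma> r (L @ M @ R) \<Omega>'"
  shows "\<exists>L' M' R'. context_split \<sigma> \<Gamma> r \<Omega>' L M R L' M' R'"
  using assms
proof (induction "length (L @ M @ R)" arbitrary: L M R rule: less_induct)
  case less
  \<comment> \<open>The given reduction decides which copy can go, so a division of the shortened
    context is required for either outcome; its split is then lifted back to \<open>L\<close>,
    \<open>M\<close>, \<open>R\<close>.\<close>
  have dup: "\<exists>L' M' R'. context_split \<sigma> \<Gamma> r \<Omega>' L M R L' M' R'"
    if "L @ M @ R = P @ e # Q @ e # S"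
      and 1: "\<exists>L1 M1 R1. L1 @ M1 @ R1 = P @ e # Q @ S \<and> (allows \<sigma> ContrL e \<longrightarrow>
        (\<forall>L' M' R'. context_split \<sigma> \<Gamma> r \<Omega>' L1 M1 R1 L' M' R' \<longrightarrow>
           context_split \<sigma> \<Gamma> r \<Omega>' L M R L' M' R'))"
      and 2: "\<exists>L1 M1 R1. L1 @ M1 @ R1 = P @ Q @ e # S \<and> (allows \<sigma> ContrR e \<longrightarrow>
        (\<forall>L' M' R'. context_split \<sigma> \<Gamma> r \<Omega>' L1 M1 R1 L' M' R' \<longrightarrow>
           context_split \<sigma> \<Gamma> r \<Omega>' L M R L' M' R'))" for P e Q S
  proof -
    have len: "length (L @ M @ R) = length (P @ e # Q @ e # S)"
      using that(1) by metis
    have "ctx_red \<sigma> \<Gamma> r (P @ e # Q @ e # S) \<Omega>'" using less.prems that(1) by simp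
    from ctx_red_contract_pair[OF this] show ?thesis
    proof (elim disjE conjE)
      assume e: "allows \<sigma> ContrL e" and r: "ctx_red \<sigma> \<Gamma> r (P @ e # Q @ S) \<Omega>'"
      obtain L1 M1 R1 where *: "L1 @ M1 @ R1 = P @ e # Q @ S"
        "\<forall>L' M' R'. context_split \<sigma> \<Gamma> r \<Omega>' L1 M1 R1 L' M' R' \<longrightarrow>
           context_split \<sigma> \<Gamma> r \<Omega>' L M R L' M' R'" using 1 e by blast
      have "length (L1 @ M1 @ R1) < length (L @ M @ R)"
        unfolding len *(1) by simp
      then show ?thesis using less.hyps[of L1 M1 R1] * r by metis
    next
      assume e: "allows \<sigma> ContrR e" and r: "ctx_red \<sigma> \<Gamma> r (P @ Q @ e # S) \<Omega>'"
      obtain L1 M1 R1 where *: "L1 @ M1 @ R1 = P @ Q @ e # S"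
        "\<forall>L' M' R'. context_split \<sigma> \<Gamma> r \<Omega>' L1 M1 R1 L' M' R' \<longrightarrow>
           context_split \<sigma> \<Gamma> r \<Omega>' L M R L' M' R'" using 2 e by blast
      have "length (L1 @ M1 @ R1) < length (L @ M @ R)"
        unfolding len *(1) by simp
      then show ?thesis using less.hyps[of L1 M1 R1] * r by metis
    qed
  qed
  \<comment> \<open>\<open>\<Omega>'\<close> contains all these hypotheses and repeats no variable,
    so here normality amounts to distinctness of hypotheses.\<close>
  have inj: "inj_on fst (set (L @ M @ R))"
    using ctx_red_set_subset[OF less.prems] inj_on_subset
    unfolding normal_ctx_def distinct_map by blast
  have normal: "normal_ctx X \<longleftrightarrow> distinct X" if "set X \<subseteq> set (L @ M @ R)" for X
    using inj_on_subset[OF inj that] by (simp add: normal_ctx_def distinct_map)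
  consider "distinct M" "distinct (L @ R)" | "\<not> distinct M" | "\<not> distinct L" | "\<not> distinct R"
    | "set L \<inter> set R \<noteq> {}" by auto
  then show ?case
  proof cases
    case 1
    then have "context_split \<sigma> \<Gamma> r \<Omega>' L M R L M R"
      using less.prems normal[of "L @ R"] normal[of M] unfolding context_split_def
      by (auto intro: r_id)
    then show ?thesis by blast
  next
    case 2
    then obtain P e Q S where M: "M = P @ e # Q @ e # S"
      using not_distinct_decomp[OF 2] by auto
    show ?thesis
    proof (rule dup[of "L @ P" e Q "S @ R"])
      show "\<exists>L1 M1 R1. L1 @ M1 @ R1 = (L @ P) @ e # Q @ S @ R \<and> (allows \<sigma> ContrL e \<longrightarrow>
        (\<forall>L' M' R'. context_split \<sigma> \<Gamma> r \<Omega>' L1 M1 R1 L' M' R' \<longrightarrow>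
           context_split \<sigma> \<Gamma> r \<Omega>' L M R L' M' R'))"
        by (rule exI[of _ L], rule exI[of _ "P @ e # Q @ S"], rule exI[of _ R])
          (auto simp: context_split_def M intro: ctx_red_contractL)
      show "\<exists>L1 M1 R1. L1 @ M1 @ R1 = (L @ P) @ Q @ e # S @ R \<and> (allows \<sigma> ContrR e \<longrightarrow>
        (\<forall>L' M' R'. context_split \<sigma> \<Gamma> r \<Omega>' L1 M1 R1 L' M' R' \<longrightarrow>
           context_split \<sigma> \<Gamma> r \<Omega>' L M R L' M' R'))"
        by (rule exI[of _ L], rule exI[of _ "P @ Q @ e # S"], rule exI[of _ R])
          (auto simp: context_split_def M intro: ctx_red_contractR)
    qed (simp add: M)
  next
    case 3
    then obtain P e Q S where L: "L = P @ e # Q @ e # S"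
      using not_distinct_decomp[OF 3] by auto
    show ?thesis
    proof (rule dup[of P e Q "S @ M @ R"])
      show "\<exists>L1 M1 R1. L1 @ M1 @ R1 = P @ e # Q @ S @ M @ R \<and> (allows \<sigma> ContrL e \<longrightarrow>
        (\<forall>L' M' R'. context_split \<sigma> \<Gamma> r \<Omega>' L1 M1 R1 L' M' R' \<longrightarrow>
           context_split \<sigma> \<Gamma> r \<Omega>' L M R L' M' R'))"
        by (rule exI[of _ "P @ e # Q @ S"], rule exI[of _ M], rule exI[of _ R])
          (auto simp: context_split_def L intro!: ctx_red_contractL)
      show "\<exists>L1 M1 R1. L1 @ M1 @ R1 = P @ Q @ e # S @ M @ R \<and> (allows \<sigma> ContrR e \<longrightarrow>
        (\<forall>L' M' R'. context_split \<sigma> \<Gamma> r \<Omega>' L1 M1 R1 L' M' R' \<longrightarrow>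
           context_split \<sigma> \<Gamma> r \<Omega>' L M R L' M' R'))"
        by (rule exI[of _ "P @ Q @ e # S"], rule exI[of _ M], rule exI[of _ R])
          (auto simp: context_split_def L intro!: ctx_red_contractR)
    qed (simp add: L)
  next
    case 4
    then obtain P e Q S where R: "R = P @ e # Q @ e # S"
      using not_distinct_decomp[OF 4] by auto
    show ?thesis
    proof (rule dup[of "L @ M @ P" e Q S])
      show "\<exists>L1 M1 R1. L1 @ M1 @ R1 = (L @ M @ P) @ e # Q @ S \<and> (allows \<sigma> ContrL e \<longrightarrow>
        (\<forall>L' M' R'. context_split \<sigma> \<Gamma> r \<Omega>' L1 M1 R1 L' M' R' \<longrightarrow>
           context_split \<sigma> \<Gamma> r \<Omega>' L M R L' M' R'))"
        using ctx_red_contractL[of \<sigma> _ _ "L @ _ @ P" e Q S]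
        by (intro exI[of _ L] exI[of _ M] exI[of _ "P @ e # Q @ S"])
          (auto simp: context_split_def R)
      show "\<exists>L1 M1 R1. L1 @ M1 @ R1 = (L @ M @ P) @ Q @ e # S \<and> (allows \<sigma> ContrR e \<longrightarrow>
        (\<forall>L' M' R'. context_split \<sigma> \<Gamma> r \<Omega>' L1 M1 R1 L' M' R' \<longrightarrow>
           context_split \<sigma> \<Gamma> r \<Omega>' L M R L' M' R'))"
        using ctx_red_contractR[of \<sigma> _ _ "L @ _ @ P" Q e S]
        by (intro exI[of _ L] exI[of _ M] exI[of _ "P @ Q @ e # S"])
          (auto simp: context_split_def R)
    qed (simp add: R)
  next
    case 5
    \<comment> \<open>The repetition straddles the gap. The same contraction applies whatever fills
      the gap, so it lifts to every \<open>X\<close>.\<close>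
    then obtain e where "e \<in> set L" "e \<in> set R" by blast
    then obtain P Q S T where LR: "L = P @ e # Q" "R = S @ e # T"
      by (meson split_list)
    show ?thesis
    proof (rule dup[of P e "Q @ M @ S" T])
      show "\<exists>L1 M1 R1. L1 @ M1 @ R1 = P @ e # (Q @ M @ S) @ T \<and> (allows \<sigma> ContrL e \<longrightarrow>
        (\<forall>L' M' R'. context_split \<sigma> \<Gamma> r \<Omega>' L1 M1 R1 L' M' R' \<longrightarrow>
           context_split \<sigma> \<Gamma> r \<Omega>' L M R L' M' R'))"
        using ctx_red_contractL[of \<sigma> _ _ P e "Q @ _ @ S" T]
        by (intro exI[of _ "P @ e # Q"] exI[of _ M] exI[of _ "S @ T"])
          (auto simp: context_split_def LR)
      show "\<exists>L1 M1 R1. L1 @ M1 @ R1 = P @ (Q @ M @ S) @ e # T \<and> (allows \<sigma> ContrR e \<longrightarrow>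
        (\<forall>L' M' R'. context_split \<sigma> \<Gamma> r \<Omega>' L1 M1 R1 L' M' R' \<longrightarrow>
           context_split \<sigma> \<Gamma> r \<Omega>' L M R L' M' R'))"
        using ctx_red_contractR[of \<sigma> _ _ P "Q @ _ @ S" e T]
        by (intro exI[of _ "P @ Q"] exI[of _ M] exI[of _ "S @ e # T"])
          (auto simp: context_split_def LR)
    qed (simp add: LR)
  qed
qed

section \<open>Reductions in larger surroundings and at other modes\<close>

lemma ctx_red_extend:
  assumes "ctx_red \<sigma> \<Gamma> r \<Omega> \<Omega>'" "\<Gamma> \<subseteq> \<Gamma>'" "normal_ctx (P @ Q)"
    and "vars (P @ Q) \<inter> (vars \<Omega> \<union> Domain \<Gamma>) = {}"
  shows "ctx_red \<sigma> \<Gamma>' r (P @ \<Omega> @ Q) (P @ \<Omega>' @ Q)"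
  using assms
proof (induction rule: ctx_red.induct)
  case (r_Weak L x A R \<Omega>')
  have "ctx_red \<sigma> \<Gamma>' r ((P @ L) @ [(x, A)] @ (R @ Q)) (P @ \<Omega>' @ Q)"
  proof -
    \<comment> \<open>A weakened hypothesis comes from \<open>\<Gamma>\<close>, whose variables are
      kept apart from \<open>P\<close> and \<open>Q\<close>.\<close>
    have "x \<notin> vars (P @ Q)" using r_Weak.hyps r_Weak.prems by blast
    then show ?thesis using r_Weak by (auto simp: vars_def)
  qed
  then have "ctx_red \<sigma> \<Gamma>' r ((P @ L) @ (R @ Q)) (P @ \<Omega>' @ Q)"
    by (rule ctx_red.r_Weak) (use r_Weak in \<open>auto simp: vars_def\<close>)
  then show ?case by simp
next
  case (r_ContrL L x A M R \<Omega>')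
  then show ?case
    using ctx_red.r_ContrL[of \<sigma> \<Gamma>' r "P @ L" x A M "R @ Q"] by (auto simp: vars_def)
next
  case (r_ContrR L M x A R \<Omega>')
  then show ?case
    using ctx_red.r_ContrR[of \<sigma> \<Gamma>' r "P @ L" M x A "R @ Q"] by (auto simp: vars_def)
next
  case (r_MobL L x A M R \<Omega>')
  then show ?case
    using ctx_red.r_MobL[of \<sigma> \<Gamma>' r "P @ L" x A M "R @ Q"] by (auto simp: vars_def)
next
  case (r_MobR L M x A R \<Omega>')
  then show ?case
    using ctx_red.r_MobR[of \<sigma> \<Gamma>' r "P @ L" M x A "R @ Q"] by (auto simp: vars_def)
next
  case (r_id \<Omega>)
  then show ?case
    by (intro ctx_red.r_id) (auto simp: normal_ctx_def vars_def)
qed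

text \<open>Only weakening mentions the mode, and its bound by \<open>m\<close> implies the bound by
  \<open>r\<close>.\<close>

lemma ctx_red_lower_mode:
  assumes "ctx_red \<sigma> \<Gamma> m \<Omega> \<Omega>'" "m \<ge> r"
  shows "ctx_red \<sigma> \<Gamma> r \<Omega> \<Omega>'"
  using assms
proof (induction rule: ctx_red.induct)
  case r_Weak
  then show ?case by (meson ctx_red.r_Weak order_trans)
next
  case r_ContrL
  then show ?case by (meson ctx_red.r_ContrL)
next
  case r_ContrR
  then show ?case by (meson ctx_red.r_ContrR)
next
  case r_MobL
  then show ?case by (meson ctx_red.r_MobL)
next
  case r_MobR
  then show ?case by (meson ctx_red.r_MobR)
next
  case r_id
  then show ?case by (simp add: ctx_red.r_id)
qed

text \<open>Weakened hypotheses lie above \<open>m\<close> as well, so the restriction in the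
  implicit rule for \<open>Up\<close> discards none of these normal forms.\<close>

lemma ctx_red_ge:
  assumes "ctx_red \<sigma> \<Gamma> m \<Omega> \<Omega>'" "ctx_ge \<Omega> m"
  shows "ctx_ge \<Omega>' m"
  using assms by (induction rule: ctx_red.induct) (auto simp: ctx_ge_def)

lemma wf_hyps_insert:
  assumes "wf_hyps \<Gamma>" "wf_form A" "x \<notin> Domain \<Gamma>"
  shows "wf_hyps (insert (x, A) \<Gamma>)"
  using assms unfolding wf_hyps_def single_valued_def by auto

lemma set_subset_insert_hyp:
  assumes "set \<Omega> \<subseteq> insert (x, A) \<Gamma>" "x \<notin> vars \<Omega>"
  shows "set \<Omega> \<subseteq> \<Gamma>"
  using assms by (force simp: vars_def)

text \<open>Well-modedness of an eliminated formula keeps the extended hypotheses well-formed;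
  containment in \<open>\<Gamma>\<close> is what \<open>ctx_red_drop\<close> asks of the
  surroundings.\<close>

lemma explicit_nd_wf:
  assumes "explicit_nd \<sigma> \<Gamma> C \<Omega>" "wf_hyps \<Gamma>"
  shows "wf_form C" "set \<Omega> \<subseteq> \<Gamma>"
proof -
  have "wf_form C \<and> set \<Omega> \<subseteq> \<Gamma>"
    using assms
  proof (induction rule: explicit_nd.induct)
    case (e_FuseE \<Gamma> A B \<Omega>M C x y \<Omega>L \<Omega>R)
    then have "wf_hyps (\<Gamma> \<union> {(x, A), (y, B)})"
      using wf_hyps_insert[OF wf_hyps_insert[of \<Gamma> B y], of A x] by auto
    with e_FuseE have IH: "wf_form C" "set (\<Omega>L @ \<Omega>R) \<subseteq> insert (x, A) (insert (y, B) \<Gamma>)"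
      by auto
    have "set (\<Omega>L @ \<Omega>R) \<subseteq> \<Gamma>"
      by (rule set_subset_insert_hyp[OF set_subset_insert_hyp[OF IH(2)]]) fact+
    with e_FuseE IH show ?case by auto
  next
    case (e_PlusE \<Gamma> A B \<Omega>M C x \<Omega>L \<Omega>R)
    then show ?case
      using wf_hyps_insert[of \<Gamma> A x] set_subset_insert_hyp[of "\<Omega>L @ \<Omega>R" x A \<Gamma>] by auto
  next
    case (e_DownE \<Gamma> m A \<Omega>M C x \<Omega>L \<Omega>R)
    then show ?case
      using wf_hyps_insert[of \<Gamma> A x] set_subset_insert_hyp[of "\<Omega>L @ \<Omega>R" x A \<Gamma>] by auto
  next
    case (e_RImpI A B x \<Gamma> \<Omega>)
    then show ?case
      using wf_hyps_insert[of \<Gamma> A x] set_subset_insert_hyp[of \<Omega> x A \<Gamma>] by auto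
  next
    case (e_LImpI A B x \<Gamma> \<Omega>)
    then show ?case
      using wf_hyps_insert[of \<Gamma> A x] set_subset_insert_hyp[of \<Omega> x A \<Gamma>] by auto
  qed (auto simp: wf_hyps_def)
  then show "wf_form C" "set \<Omega> \<subseteq> \<Gamma>" by auto
qed

section \<open>Normal forms of contexts and of their parts\<close>

lemma vars_append: "vars (P @ Q) = vars P \<union> vars Q"
  by (simp add: vars_def image_Un)

lemma normal_ctx_append:
  "normal_ctx (P @ Q) \<longleftrightarrow> normal_ctx P \<and> normal_ctx Q \<and> vars P \<inter> vars Q = {}"
  by (simp add: normal_ctx_def vars_def)

text \<open>Freshness and normality of \<open>X\<close> make \<open>L' @ X @ R'\<close> normal; the
  empty \<open>X\<close> gives the clause for \<open>L @ R\<close>.\<close>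

lemma NF_split:
  assumes "\<Omega>' \<in> NF \<sigma> \<Gamma> r (L @ M @ R)"
  obtains L' M' R' where
    "\<Omega>' \<in> NF \<sigma> \<Gamma> r (L' @ M' @ R')"
    "\<And>\<Gamma> r. M' \<in> NF \<sigma> \<Gamma> r M"
    "\<And>\<Gamma> r. L' @ R' \<in> NF \<sigma> \<Gamma> r (L @ R)"
    "\<And>\<Gamma> r X. normal_ctx X \<Longrightarrow> vars X \<inter> vars (L @ R) = {} \<Longrightarrow>
      L' @ X @ R' \<in> NF \<sigma> \<Gamma> r (L @ X @ R)"
    "set L' \<subseteq> set L" "set R' \<subseteq> set R"
proof -
  obtain L' M' R' where s: "context_split \<sigma> \<Gamma> r \<Omega>' L M R L' M' R'"
    using ctx_red_split assms unfolding NF_def by blast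
  have n: "normal_ctx (L' @ R')" and M': "\<And>\<Gamma> r. ctx_red \<sigma> \<Gamma> r M M'"
    and \<Omega>': "ctx_red \<sigma> \<Gamma> r (L' @ M' @ R') \<Omega>'"
    and sub: "set L' \<subseteq> set L" "set R' \<subseteq> set R"
    and red: "\<And>\<Gamma> r X. normal_ctx (L' @ X @ R') \<Longrightarrow> ctx_red \<sigma> \<Gamma> r (L @ X @ R) (L' @ X @ R')"
    using s unfolding context_split_def by blast+
  have "vars L' \<subseteq> vars L" "vars R' \<subseteq> vars R"
    using sub by (simp_all add: vars_def image_mono)
  then have X: "ctx_red \<sigma> \<Gamma> r (L @ X @ R) (L' @ X @ R')"
    if "normal_ctx X" "vars X \<inter> vars (L @ R) = {}" for \<Gamma> r X
    using n that by (intro red) (auto simp: normal_ctx_append vars_append)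
  then have "ctx_red \<sigma> \<Gamma> r (L @ R) (L' @ R')" for \<Gamma> r
    using red[of "[]" \<Gamma> r] n by simp
  with M' \<Omega>' X sub show ?thesis
    by (intro that[of L' M' R']) (simp_all add: NF_def)
qed

lemma NF_split2:
  assumes "\<Omega>' \<in> NF \<sigma> \<Gamma> r (L @ M)"
  obtains L' M' where "\<Omega>' \<in> NF \<sigma> \<Gamma> r (L' @ M')"
    "\<And>\<Gamma> r. L' \<in> NF \<sigma> \<Gamma> r L" "\<And>\<Gamma> r. M' \<in> NF \<sigma> \<Gamma> r M"
proof -
  have "\<Omega>' \<in> NF \<sigma> \<Gamma> r (L @ M @ [])" using assms by simp
  from NF_split[OF this] obtain L' M' R' where
    *: "\<Omega>' \<in> NF \<sigma> \<Gamma> r (L' @ M' @ R')" "\<And>\<Gamma> r. M' \<in> NF \<sigma> \<Gamma> r M"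
      "\<And>\<Gamma> r. L' @ R' \<in> NF \<sigma> \<Gamma> r (L @ [])" "set R' \<subseteq> set []"
    by metis
  then have "R' = []" by simp
  with * show ?thesis by (intro that[of L' M']) simp_all
qed

lemma in_NFsI:
  assumes "\<Omega>' \<in> NF \<sigma> \<Gamma> r \<Omega>" "\<Omega> \<in> \<Xi>"
  shows "\<Omega>' \<in> NFs \<sigma> \<Gamma> r \<Xi>"
  using assms by (auto simp: NFs_def)

text \<open>Carries the existence of a normal form from a conclusion to its premises, whose
  hypotheses and modes may differ.\<close>

lemma NF_split_nonempty:
  assumes "NF \<sigma> \<Gamma> r (L @ M @ R) \<noteq> {}"
  shows "NF \<sigma> \<Gamma>' r' M \<noteq> {}" "NF \<sigma> \<Gamma>' r' (L @ R) \<noteq> {}"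
    "normal_ctx X \<Longrightarrow> vars X \<inter> vars (L @ R) = {} \<Longrightarrow> NF \<sigma> \<Gamma>' r' (L @ X @ R) \<noteq> {}"
proof -
  obtain \<Omega>' where "\<Omega>' \<in> NF \<sigma> \<Gamma> r (L @ M @ R)" using assms by blast
  from NF_split[OF this] obtain L' M' R' where *: "M' \<in> NF \<sigma> \<Gamma>' r' M"
    "L' @ R' \<in> NF \<sigma> \<Gamma>' r' (L @ R)"
    "\<And>X. normal_ctx X \<Longrightarrow> vars X \<inter> vars (L @ R) = {} \<Longrightarrow> L' @ X @ R' \<in> NF \<sigma> \<Gamma>' r' (L @ X @ R)"
    by metis
  show "NF \<sigma> \<Gamma>' r' M \<noteq> {}" "NF \<sigma> \<Gamma>' r' (L @ R) \<noteq> {}" using *(1,2) by blast+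
  show "NF \<sigma> \<Gamma>' r' (L @ X @ R) \<noteq> {}" if "normal_ctx X" "vars X \<inter> vars (L @ R) = {}"
    using *(3)[OF that] by blast
qed

lemma NF_split2_nonempty:
  assumes "NF \<sigma> \<Gamma> r (L @ R) \<noteq> {}"
  shows "NF \<sigma> \<Gamma>' r' L \<noteq> {}" "NF \<sigma> \<Gamma>' r' R \<noteq> {}"
  using NF_split_nonempty[of \<sigma> \<Gamma> r "[]" L R] NF_split_nonempty[of \<sigma> \<Gamma> r L R "[]"] assms
  by auto

text \<open>The factors are normalised separately; a hypothesis common to both is contracted in the
  outer reduction.\<close>

lemma NF_subset_NFs_juxt:
  assumes "NF \<sigma> \<Gamma> k L \<subseteq> \<Xi>L" "NF \<sigma> \<Gamma> l R \<subseteq> \<Xi>R"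
  shows "NF \<sigma> \<Gamma> r (L @ R) \<subseteq> NFs \<sigma> \<Gamma> r (juxt \<Xi>L \<Xi>R)"
proof
  fix \<Omega>' assume "\<Omega>' \<in> NF \<sigma> \<Gamma> r (L @ R)"
  from NF_split2[OF this] obtain L' R' where
    "\<Omega>' \<in> NF \<sigma> \<Gamma> r (L' @ R')" "L' \<in> \<Xi>L" "R' \<in> \<Xi>R"
    using assms by (metis subsetD)
  then show "\<Omega>' \<in> NFs \<sigma> \<Gamma> r (juxt \<Xi>L \<Xi>R)"
    by (intro in_NFsI[of _ _ _ _ "L' @ R'"]) (auto simp: juxt_def)
qed

text \<open>Contraction alone reaches a normal form valid at mode \<open>k\<close>, and the rest of
  the reduction follows at mode \<open>r\<close>. This handles the change of mode at a
  shift.\<close>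

lemma NF_subset_NFs:
  assumes "NF \<sigma> \<Gamma> k \<Omega> \<subseteq> \<Xi>"
  shows "NF \<sigma> \<Gamma> r \<Omega> \<subseteq> NFs \<sigma> \<Gamma> r \<Xi>"
proof
  fix \<Omega>' assume "\<Omega>' \<in> NF \<sigma> \<Gamma> r \<Omega>"
  then have "\<Omega>' \<in> NF \<sigma> \<Gamma> r ([] @ \<Omega> @ [])" by simp
  from NF_split[OF this] obtain L' M' R' where *: "\<Omega>' \<in> NF \<sigma> \<Gamma> r (L' @ M' @ R')"
    "M' \<in> NF \<sigma> \<Gamma> k \<Omega>" "set R' \<subseteq> set []" "set L' \<subseteq> set []"
    by metis
  then have "\<Omega>' \<in> NF \<sigma> \<Gamma> r M'" by simp
  then show "\<Omega>' \<in> NFs \<sigma> \<Gamma> r \<Xi>"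
    using *(2) assms by (blast intro: in_NFsI)
qed

section \<open>Completeness of the implicit system\<close>

text \<open>A context without normal form may have no implicit counterpart, and the last assumption
  sets such contexts aside. Wherever an implicit rule asks for a nonempty output, the inclusion
  being proved supplies it.\<close>

theorem theorem9:
  fixes \<sigma> :: "'m::preorder \<Rightarrow> structural set"
    and \<Gamma> :: "('v, 'm, 'p) hyps" and C :: "('m, 'p) form" and \<Omega> :: "('v, 'm, 'p) octx"
  assumes "adjoint_modes \<sigma>"
    and "wf_hyps \<Gamma>"
    and "explicit_nd \<sigma> \<Gamma> C \<Omega>"
    and "NF \<sigma> \<Gamma> (mode_of C) \<Omega> \<noteq> {}"
  shows "\<exists>\<Xi>. implicit_nd \<sigma> \<Gamma> C \<Xi> \<and> NF \<sigma> \<Gamma> (mode_of C) \<Omega> \<subseteq> \<Xi>"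
  using assms(3,1,2,4)
proof (induction rule: explicit_nd.induct)
  case (e_hyp x A \<Gamma>)
  then show ?case
    using i_hyp[OF e_hyp.hyps refl] by (auto simp: NFs_def)
next
  case (e_OneI \<Gamma> m)
  then show ?case
    using i_OneI[OF refl, of \<sigma> \<Gamma> m] by (auto simp: NFs_def)
next
  case (e_OneE \<Gamma> m M C L R)
  have "NF \<sigma> \<Gamma> m M \<noteq> {}" "NF \<sigma> \<Gamma> (mode_of C) (L @ R) \<noteq> {}"
    using NF_split_nonempty(1,2) e_OneE.prems(3) by metis+
  with e_OneE obtain \<Xi>M \<Xi>' where
    IH: "implicit_nd \<sigma> \<Gamma> (One m) \<Xi>M" "NF \<sigma> \<Gamma> m M \<subseteq> \<Xi>M"
      "implicit_nd \<sigma> \<Gamma> C \<Xi>'" "NF \<sigma> \<Gamma> (mode_of C) (L @ R) \<subseteq> \<Xi>'"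
    by auto
  let ?\<Xi> = "NFs \<sigma> \<Gamma> (mode_of C) {\<Omega>L @ \<Omega>M @ \<Omega>R | \<Omega>L \<Omega>M \<Omega>R. \<Omega>L @ \<Omega>R \<in> \<Xi>' \<and> \<Omega>M \<in> \<Xi>M}"
  have sub: "NF \<sigma> \<Gamma> (mode_of C) (L @ M @ R) \<subseteq> ?\<Xi>"
  proof
    fix \<Omega>' assume "\<Omega>' \<in> NF \<sigma> \<Gamma> (mode_of C) (L @ M @ R)"
    from NF_split[OF this] obtain L' M' R' where
      *: "\<Omega>' \<in> NF \<sigma> \<Gamma> (mode_of C) (L' @ M' @ R')" "M' \<in> NF \<sigma> \<Gamma> m M"
        "L' @ R' \<in> NF \<sigma> \<Gamma> (mode_of C) (L @ R)"
      by metis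
    then have "L' @ R' \<in> \<Xi>'" "M' \<in> \<Xi>M" using IH by blast+
    with *(1) show "\<Omega>' \<in> ?\<Xi>" by (blast intro: in_NFsI)
  qed
  then have "?\<Xi> \<noteq> {}" using e_OneE.prems by blast
  then show ?case using i_OneE[OF IH(1) e_OneE.hyps(2) IH(3) refl] sub by blast
next
  case (e_FuseI A B \<Gamma> L R)
  have "NF \<sigma> \<Gamma> (mode_of A) L \<noteq> {}" "NF \<sigma> \<Gamma> (mode_of B) R \<noteq> {}"
    using NF_split2_nonempty e_FuseI.prems(3) by metis+
  with e_FuseI obtain \<Xi>L \<Xi>R where
    IH: "implicit_nd \<sigma> \<Gamma> A \<Xi>L" "NF \<sigma> \<Gamma> (mode_of A) L \<subseteq> \<Xi>L"
      "implicit_nd \<sigma> \<Gamma> B \<Xi>R" "NF \<sigma> \<Gamma> (mode_of B) R \<subseteq> \<Xi>R"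
    by auto
  let ?\<Xi> = "NFs \<sigma> \<Gamma> (mode_of (Fuse A B)) (juxt \<Xi>L \<Xi>R)"
  have sub: "NF \<sigma> \<Gamma> (mode_of (Fuse A B)) (L @ R) \<subseteq> ?\<Xi>"
    by (rule NF_subset_NFs_juxt[OF IH(2,4)])
  then have "?\<Xi> \<noteq> {}" using e_FuseI.prems by blast
  then show ?case using i_FuseI[OF e_FuseI.hyps(1) IH(1,3) refl] sub by blast
next
  case (e_FuseE \<Gamma> A B M C x y L R)
  let ?\<Gamma> = "\<Gamma> \<union> {(x, A), (y, B)}"
  \<comment> \<open>The two bound hypotheses form one inserted block, so they stay adjacent as the
    implicit rule requires.\<close>
  let ?X = "[(x, A)] @ [(y, B)]"
  have X: "normal_ctx ?X" "vars ?X \<inter> vars (L @ R) = {}"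
    using e_FuseE.hyps by (auto simp: normal_ctx_def vars_def)
  have "wf_form (Fuse A B)"
    using explicit_nd_wf(1)[OF e_FuseE.hyps(1)] e_FuseE.prems by blast
  then have "wf_hyps (insert (x, A) (insert (y, B) \<Gamma>))"
    using e_FuseE.hyps e_FuseE.prems by (intro wf_hyps_insert) auto
  then have wf: "wf_hyps ?\<Gamma>" by (simp add: insert_commute Un_commute)
  have "NF \<sigma> \<Gamma> (mode_of (Fuse A B)) M \<noteq> {}"
    using NF_split_nonempty(1) e_FuseE.prems(3) by metis
  moreover have "NF \<sigma> ?\<Gamma> (mode_of C) (L @ [(x, A)] @ [(y, B)] @ R) \<noteq> {}"
    using NF_split_nonempty(3)[OF e_FuseE.prems(3) X] by simp
  ultimately obtain \<Xi>M \<Xi>' where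
    IH: "implicit_nd \<sigma> \<Gamma> (Fuse A B) \<Xi>M" "NF \<sigma> \<Gamma> (mode_of (Fuse A B)) M \<subseteq> \<Xi>M"
      "implicit_nd \<sigma> ?\<Gamma> C \<Xi>'" "NF \<sigma> ?\<Gamma> (mode_of C) (L @ [(x, A)] @ [(y, B)] @ R) \<subseteq> \<Xi>'"
    using e_FuseE.IH e_FuseE.prems wf by blast
  let ?\<Xi> = "NFs \<sigma> \<Gamma> (mode_of C) {\<Omega>L @ \<Omega>M @ \<Omega>R | \<Omega>L \<Omega>M \<Omega>R.
            \<Omega>L @ [(x, A)] @ [(y, B)] @ \<Omega>R \<in> \<Xi>' \<and> \<Omega>M \<in> \<Xi>M}"
  have sub: "NF \<sigma> \<Gamma> (mode_of C) (L @ M @ R) \<subseteq> ?\<Xi>"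
  proof
    fix \<Omega>' assume "\<Omega>' \<in> NF \<sigma> \<Gamma> (mode_of C) (L @ M @ R)"
    from NF_split[OF this] obtain L' M' R' where
      *: "\<Omega>' \<in> NF \<sigma> \<Gamma> (mode_of C) (L' @ M' @ R')" "M' \<in> NF \<sigma> \<Gamma> (mode_of (Fuse A B)) M"
        "L' @ ?X @ R' \<in> NF \<sigma> ?\<Gamma> (mode_of C) (L @ ?X @ R)"
      using X by metis
    then have "L' @ [(x, A)] @ [(y, B)] @ R' \<in> \<Xi>'" "M' \<in> \<Xi>M"
      using IH by auto
    with *(1) show "\<Omega>' \<in> ?\<Xi>" by (blast intro: in_NFsI)
  qed
  then have "?\<Xi> \<noteq> {}" using e_FuseE.prems by blast
  then show ?case
    using i_FuseE[OF IH(1) e_FuseE.hyps(2-5) IH(3) refl] sub by blast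
next
  case (e_PlusI1 A B \<Gamma> \<Omega>)
  then have "mode_of (Plus A B) = mode_of A" by simp
  then show ?case using e_PlusI1 i_PlusI1 by metis
next
  case (e_PlusI2 A B \<Gamma> \<Omega>)
  then have "mode_of (Plus A B) = mode_of B" by simp
  then show ?case using e_PlusI2 i_PlusI2 by metis
next
  case (e_PlusE \<Gamma> A B M C x L R)
  have X: "normal_ctx [(x, D)]" "vars [(x, D)] \<inter> vars (L @ R) = {}" for D :: "('a, 'c) form"
    using e_PlusE.hyps by (auto simp: normal_ctx_def vars_def)
  have "wf_form (Plus A B)"
    using explicit_nd_wf(1)[OF e_PlusE.hyps(1)] e_PlusE.prems by blast
  then have wf: "wf_hyps (\<Gamma> \<union> {(x, A)})" "wf_hyps (\<Gamma> \<union> {(x, B)})"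
    using wf_hyps_insert[of \<Gamma> A x] wf_hyps_insert[of \<Gamma> B x] e_PlusE.hyps e_PlusE.prems
    by simp_all
  have "NF \<sigma> \<Gamma> (mode_of (Plus A B)) M \<noteq> {}"
    using NF_split_nonempty(1) e_PlusE.prems(3) by metis
  moreover have "NF \<sigma> (\<Gamma> \<union> {(x, D)}) (mode_of C) (L @ [(x, D)] @ R) \<noteq> {}" for D
    using NF_split_nonempty(3)[OF e_PlusE.prems(3) X] .
  ultimately obtain \<Xi>M \<Xi>A \<Xi>B where
    IH: "implicit_nd \<sigma> \<Gamma> (Plus A B) \<Xi>M" "NF \<sigma> \<Gamma> (mode_of (Plus A B)) M \<subseteq> \<Xi>M"
      "implicit_nd \<sigma> (\<Gamma> \<union> {(x, A)}) C \<Xi>A"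
      "NF \<sigma> (\<Gamma> \<union> {(x, A)}) (mode_of C) (L @ [(x, A)] @ R) \<subseteq> \<Xi>A"
      "implicit_nd \<sigma> (\<Gamma> \<union> {(x, B)}) C \<Xi>B"
      "NF \<sigma> (\<Gamma> \<union> {(x, B)}) (mode_of C) (L @ [(x, B)] @ R) \<subseteq> \<Xi>B"
    using e_PlusE.IH e_PlusE.prems wf by meson
  let ?\<Xi> = "NFs \<sigma> \<Gamma> (mode_of C) {\<Omega>L @ \<Omega>M @ \<Omega>R | \<Omega>L \<Omega>M \<Omega>R.
            \<Omega>L @ [(x, A)] @ \<Omega>R \<in> \<Xi>A \<and> \<Omega>L @ [(x, B)] @ \<Omega>R \<in> \<Xi>B \<and> \<Omega>M \<in> \<Xi>M}"
  have sub: "NF \<sigma> \<Gamma> (mode_of C) (L @ M @ R) \<subseteq> ?\<Xi>"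
  proof
    fix \<Omega>' assume "\<Omega>' \<in> NF \<sigma> \<Gamma> (mode_of C) (L @ M @ R)"
    \<comment> \<open>One pair \<open>L'\<close>, \<open>R'\<close> serves both branches because it
      does not depend on \<open>D\<close>; separate splits need not agree.\<close>
    from NF_split[OF this] obtain L' M' R' where
      *: "\<Omega>' \<in> NF \<sigma> \<Gamma> (mode_of C) (L' @ M' @ R')" "M' \<in> NF \<sigma> \<Gamma> (mode_of (Plus A B)) M"
        "\<And>D. L' @ [(x, D)] @ R' \<in> NF \<sigma> (\<Gamma> \<union> {(x, D)}) (mode_of C) (L @ [(x, D)] @ R)"
      using X by metis
    then have "L' @ [(x, A)] @ R' \<in> \<Xi>A" "L' @ [(x, B)] @ R' \<in> \<Xi>B" "M' \<in> \<Xi>M"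
      using IH by blast+
    with *(1) show "\<Omega>' \<in> ?\<Xi>" by (blast intro: in_NFsI)
  qed
  then have "?\<Xi> \<noteq> {}" using e_PlusE.prems by blast
  then show ?case
    using i_PlusE[OF IH(1) e_PlusE.hyps(2,3) IH(3,5) refl] sub by blast
next
  case (e_DownI m A \<Gamma> \<Omega>)
  have "NF \<sigma> \<Gamma> (mode_of A) \<Omega> \<noteq> {}"
    using NF_split2_nonempty(2)[of \<sigma> \<Gamma> _ "[]" \<Omega>] e_DownI.prems(3) by simp
  with e_DownI obtain \<Xi>' where IH: "implicit_nd \<sigma> \<Gamma> A \<Xi>'" "NF \<sigma> \<Gamma> (mode_of A) \<Omega> \<subseteq> \<Xi>'"
    by blast
  have sub: "NF \<sigma> \<Gamma> m \<Omega> \<subseteq> NFs \<sigma> \<Gamma> m \<Xi>'"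
    by (rule NF_subset_NFs[OF IH(2)])
  then have "NFs \<sigma> \<Gamma> m \<Xi>' \<noteq> {}" using e_DownI.prems by auto
  then show ?case
    using i_DownI[OF e_DownI.hyps(1) IH(1) refl] sub by auto
next
  case (e_DownE \<Gamma> m A M C x L R)
  have X: "normal_ctx [(x, A)]" "vars [(x, A)] \<inter> vars (L @ R) = {}"
    using e_DownE.hyps by (auto simp: normal_ctx_def vars_def)
  have "wf_form (Down m A)"
    using explicit_nd_wf(1)[OF e_DownE.hyps(1)] e_DownE.prems by blast
  then have wf: "wf_hyps (\<Gamma> \<union> {(x, A)})"
    using wf_hyps_insert[of \<Gamma> A x] e_DownE.hyps e_DownE.prems by simp
  have "NF \<sigma> \<Gamma> (mode_of (Down m A)) M \<noteq> {}"
    using NF_split_nonempty(1) e_DownE.prems(3) by metis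
  moreover have "NF \<sigma> (\<Gamma> \<union> {(x, A)}) (mode_of C) (L @ [(x, A)] @ R) \<noteq> {}"
    using NF_split_nonempty(3)[OF e_DownE.prems(3) X] .
  ultimately obtain \<Xi>M \<Xi>' where
    IH: "implicit_nd \<sigma> \<Gamma> (Down m A) \<Xi>M" "NF \<sigma> \<Gamma> (mode_of (Down m A)) M \<subseteq> \<Xi>M"
      "implicit_nd \<sigma> (\<Gamma> \<union> {(x, A)}) C \<Xi>'"
      "NF \<sigma> (\<Gamma> \<union> {(x, A)}) (mode_of C) (L @ [(x, A)] @ R) \<subseteq> \<Xi>'"
    using e_DownE.IH e_DownE.prems wf by meson
  let ?\<Xi> = "NFs \<sigma> \<Gamma> (mode_of C) {\<Omega>L @ \<Omega>M @ \<Omega>R | \<Omega>L \<Omega>M \<Omega>R.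
            \<Omega>L @ [(x, A)] @ \<Omega>R \<in> \<Xi>' \<and> \<Omega>M \<in> \<Xi>M}"
  have sub: "NF \<sigma> \<Gamma> (mode_of C) (L @ M @ R) \<subseteq> ?\<Xi>"
  proof
    fix \<Omega>' assume "\<Omega>' \<in> NF \<sigma> \<Gamma> (mode_of C) (L @ M @ R)"
    from NF_split[OF this] obtain L' M' R' where
      *: "\<Omega>' \<in> NF \<sigma> \<Gamma> (mode_of C) (L' @ M' @ R')" "M' \<in> NF \<sigma> \<Gamma> (mode_of (Down m A)) M"
        "L' @ [(x, A)] @ R' \<in> NF \<sigma> (\<Gamma> \<union> {(x, A)}) (mode_of C) (L @ [(x, A)] @ R)"
      using X by metis
    then have "L' @ [(x, A)] @ R' \<in> \<Xi>'" "M' \<in> \<Xi>M"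
      using IH by blast+
    with *(1) show "\<Omega>' \<in> ?\<Xi>" by (blast intro: in_NFsI)
  qed
  then have "?\<Xi> \<noteq> {}" using e_DownE.prems by blast
  then show ?case
    using i_DownE[OF IH(1) e_DownE.hyps(2,3) IH(3) refl] sub by blast
next
  case (e_RImpI A B x \<Gamma> \<Omega>)
  have wf: "wf_hyps (\<Gamma> \<union> {(x, A)})"
    using wf_hyps_insert[of \<Gamma> A x] e_RImpI.hyps e_RImpI.prems by simp
  have m: "mode_of (RImp A B) = mode_of B" using e_RImpI.hyps(1) by simp
  \<comment> \<open>The bound hypothesis waits at the right end; as \<open>x\<close> is not declared
    in \<open>\<Gamma>\<close>, no weakening introduces it a second time.\<close>
  have ext: "\<Omega>' @ [(x, A)] \<in> NF \<sigma> (\<Gamma> \<union> {(x, A)}) (mode_of B) (\<Omega> @ [(x, A)])"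
    if "\<Omega>' \<in> NF \<sigma> \<Gamma> (mode_of (RImp A B)) \<Omega>" for \<Omega>'
    using ctx_red_extend[of \<sigma> \<Gamma> "mode_of B" \<Omega> \<Omega>' "\<Gamma> \<union> {(x, A)}" "[]" "[(x, A)]"]
      that e_RImpI.hyps unfolding m by (auto simp: NF_def normal_ctx_def vars_def)
  then have "NF \<sigma> (\<Gamma> \<union> {(x, A)}) (mode_of B) (\<Omega> @ [(x, A)]) \<noteq> {}"
    using e_RImpI.prems by blast
  with e_RImpI wf obtain \<Xi>' where IH: "implicit_nd \<sigma> (\<Gamma> \<union> {(x, A)}) B \<Xi>'"
    "NF \<sigma> (\<Gamma> \<union> {(x, A)}) (mode_of B) (\<Omega> @ [(x, A)]) \<subseteq> \<Xi>'" by blast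
  have sub: "NF \<sigma> \<Gamma> (mode_of (RImp A B)) \<Omega> \<subseteq> {\<Omega>. \<Omega> @ [(x, A)] \<in> \<Xi>'}"
    using ext IH(2) by blast
  then have "{\<Omega>. \<Omega> @ [(x, A)] \<in> \<Xi>'} \<noteq> {}" using e_RImpI.prems by blast
  then show ?case
    using i_RImpI[OF e_RImpI.hyps(1,2) IH(1) refl] sub by blast
next
  case (e_RImpE \<Gamma> A B L R)
  have "NF \<sigma> \<Gamma> (mode_of (RImp A B)) L \<noteq> {}" "NF \<sigma> \<Gamma> (mode_of A) R \<noteq> {}"
    using NF_split2_nonempty e_RImpE.prems(3) by metis+
  with e_RImpE obtain \<Xi>L \<Xi>R where
    IH: "implicit_nd \<sigma> \<Gamma> (RImp A B) \<Xi>L" "NF \<sigma> \<Gamma> (mode_of (RImp A B)) L \<subseteq> \<Xi>L"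
      "implicit_nd \<sigma> \<Gamma> A \<Xi>R" "NF \<sigma> \<Gamma> (mode_of A) R \<subseteq> \<Xi>R"
    by meson
  have sub: "NF \<sigma> \<Gamma> (mode_of B) (L @ R) \<subseteq> NFs \<sigma> \<Gamma> (mode_of B) (juxt \<Xi>L \<Xi>R)"
    by (rule NF_subset_NFs_juxt[OF IH(2,4)])
  then have "NFs \<sigma> \<Gamma> (mode_of B) (juxt \<Xi>L \<Xi>R) \<noteq> {}" using e_RImpE.prems by blast
  then show ?case using i_RImpE[OF IH(1,3) refl] sub by blast
next
  case (e_LImpI A B x \<Gamma> \<Omega>)
  have wf: "wf_hyps (\<Gamma> \<union> {(x, A)})"
    using wf_hyps_insert[of \<Gamma> A x] e_LImpI.hyps e_LImpI.prems by simp
  have m: "mode_of (LImp A B) = mode_of B" using e_LImpI.hyps(1) by simp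
  have ext: "[(x, A)] @ \<Omega>' \<in> NF \<sigma> (\<Gamma> \<union> {(x, A)}) (mode_of B) ([(x, A)] @ \<Omega>)"
    if "\<Omega>' \<in> NF \<sigma> \<Gamma> (mode_of (LImp A B)) \<Omega>" for \<Omega>'
    using ctx_red_extend[of \<sigma> \<Gamma> "mode_of B" \<Omega> \<Omega>' "\<Gamma> \<union> {(x, A)}" "[(x, A)]" "[]"]
      that e_LImpI.hyps unfolding m by (auto simp: NF_def normal_ctx_def vars_def)
  then have "NF \<sigma> (\<Gamma> \<union> {(x, A)}) (mode_of B) ([(x, A)] @ \<Omega>) \<noteq> {}"
    using e_LImpI.prems by blast
  with e_LImpI wf obtain \<Xi>' where IH: "implicit_nd \<sigma> (\<Gamma> \<union> {(x, A)}) B \<Xi>'"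
    "NF \<sigma> (\<Gamma> \<union> {(x, A)}) (mode_of B) ([(x, A)] @ \<Omega>) \<subseteq> \<Xi>'" by blast
  have sub: "NF \<sigma> \<Gamma> (mode_of (LImp A B)) \<Omega> \<subseteq> {\<Omega>. [(x, A)] @ \<Omega> \<in> \<Xi>'}"
    using ext IH(2) by blast
  then have "{\<Omega>. [(x, A)] @ \<Omega> \<in> \<Xi>'} \<noteq> {}" using e_LImpI.prems by blast
  then show ?case
    using i_LImpI[OF e_LImpI.hyps(1,2) IH(1) refl] sub by blast
next
  case (e_LImpE \<Gamma> A B R L)
  have "NF \<sigma> \<Gamma> (mode_of (LImp A B)) R \<noteq> {}" "NF \<sigma> \<Gamma> (mode_of A) L \<noteq> {}"
    using NF_split2_nonempty e_LImpE.prems(3) by metis+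
  with e_LImpE obtain \<Xi>L \<Xi>R where
    IH: "implicit_nd \<sigma> \<Gamma> (LImp A B) \<Xi>R" "NF \<sigma> \<Gamma> (mode_of (LImp A B)) R \<subseteq> \<Xi>R"
      "implicit_nd \<sigma> \<Gamma> A \<Xi>L" "NF \<sigma> \<Gamma> (mode_of A) L \<subseteq> \<Xi>L"
    by meson
  have sub: "NF \<sigma> \<Gamma> (mode_of B) (L @ R) \<subseteq> NFs \<sigma> \<Gamma> (mode_of B) (juxt \<Xi>L \<Xi>R)"
    by (rule NF_subset_NFs_juxt[OF IH(4,2)])
  then have "NFs \<sigma> \<Gamma> (mode_of B) (juxt \<Xi>L \<Xi>R) \<noteq> {}" using e_LImpE.prems by blast
  then show ?case using i_LImpE[OF IH(1,3) refl] sub by blast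
next
  case (e_WithI A B \<Gamma> \<Omega>)
  have m: "mode_of (With A B) = mode_of A" "mode_of (With A B) = mode_of B"
    using e_WithI.hyps(1) by simp_all
  with e_WithI obtain \<Xi>A \<Xi>B where
    IH: "implicit_nd \<sigma> \<Gamma> A \<Xi>A" "NF \<sigma> \<Gamma> (mode_of (With A B)) \<Omega> \<subseteq> \<Xi>A"
      "implicit_nd \<sigma> \<Gamma> B \<Xi>B" "NF \<sigma> \<Gamma> (mode_of (With A B)) \<Omega> \<subseteq> \<Xi>B"
    by metis
  then have "\<Xi>A \<inter> \<Xi>B \<noteq> {}" using e_WithI.prems by blast
  then show ?case using i_WithI[OF e_WithI.hyps(1) IH(1,3) refl] IH(2,4) by blast
next
  case (e_WithE1 \<Gamma> A B \<Omega>)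
  have "mode_of (With A B) = mode_of A" by simp
  then show ?case using e_WithE1 i_WithE1 by metis
next
  case (e_WithE2 \<Gamma> A B \<Omega>)
  have "wf_form (With A B)"
    using explicit_nd_wf(1)[OF e_WithE2.hyps(1)] e_WithE2.prems by blast
  then have "mode_of (With A B) = mode_of B" by simp
  then show ?case using e_WithE2 i_WithE2 by metis
next
  case (e_UpI m A \<Gamma> \<Omega>)
  \<comment> \<open>Well-modedness of the shift gives \<open>m \<ge> mode_of A\<close>, so the lower
    mode of the premise admits all these normal forms.\<close>
  have sub0: "NF \<sigma> \<Gamma> m \<Omega> \<subseteq> NF \<sigma> \<Gamma> (mode_of A) \<Omega>"
    using ctx_red_lower_mode[of \<sigma> \<Gamma> m \<Omega>] e_UpI.hyps(1) by (auto simp: NF_def)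
  with e_UpI obtain \<Xi>' where IH: "implicit_nd \<sigma> \<Gamma> A \<Xi>'" "NF \<sigma> \<Gamma> (mode_of A) \<Omega> \<subseteq> \<Xi>'"
    by fastforce
  have sub: "NF \<sigma> \<Gamma> m \<Omega> \<subseteq> restr \<Xi>' m"
    using sub0 IH(2) ctx_red_ge[of \<sigma> \<Gamma> m \<Omega>] e_UpI.hyps(3) by (auto simp: NF_def restr_def)
  then have "restr \<Xi>' m \<noteq> {}" using e_UpI.prems by auto
  then show ?case using i_UpI[OF e_UpI.hyps(1) IH(1) refl] sub by auto
next
  case (e_UpE \<Gamma> m A \<Omega>)
  have "NF \<sigma> \<Gamma> (mode_of (Up m A)) \<Omega> \<noteq> {}"
    using NF_split2_nonempty(2)[of \<sigma> \<Gamma> _ "[]" \<Omega>] e_UpE.prems(3) by simp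
  with e_UpE obtain \<Xi>' where IH: "implicit_nd \<sigma> \<Gamma> (Up m A) \<Xi>'"
    "NF \<sigma> \<Gamma> (mode_of (Up m A)) \<Omega> \<subseteq> \<Xi>'"
    by blast
  have sub: "NF \<sigma> \<Gamma> (mode_of A) \<Omega> \<subseteq> NFs \<sigma> \<Gamma> (mode_of A) \<Xi>'"
    by (rule NF_subset_NFs[OF IH(2)])
  then have "NFs \<sigma> \<Gamma> (mode_of A) \<Xi>' \<noteq> {}" using e_UpE.prems by auto
  then show ?case using i_UpE[OF IH(1) refl] sub by auto
next
  case (e_Weak \<Gamma> C L R x A)
  have "set (L @ R) \<subseteq> \<Gamma>"
    using explicit_nd_wf(2)[OF e_Weak.hyps(1)] e_Weak.prems by blast
  \<comment> \<open>The explicit rule may add a further copy of a hypothesis already used, which a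
    weakening step of the reduction cannot.\<close>
  then have "NF \<sigma> \<Gamma> (mode_of C) (L @ [(x, A)] @ R) \<subseteq> NF \<sigma> \<Gamma> (mode_of C) (L @ R)"
    using ctx_red_drop[of \<sigma> \<Gamma> "mode_of C" L "(x, A)" R] e_Weak.hyps e_Weak.prems
    by (auto simp: NF_def wf_hyps_def)
  with e_Weak show ?case by fast
next
  case (e_ContrR \<Gamma> C L x A M R)
  \<comment> \<open>The rule leads from premise context to conclusion context just as one reduction
    step does, so the implicit derivation of the premise serves unchanged.\<close>
  then have "NF \<sigma> \<Gamma> (mode_of C) (L @ M @ [(x, A)] @ R)
      \<subseteq> NF \<sigma> \<Gamma> (mode_of C) (L @ [(x, A)] @ M @ [(x, A)] @ R)"
    using r_ContrR unfolding NF_def by fast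
  with e_ContrR show ?case by fast
next
  case (e_ContrL \<Gamma> C L x A M R)
  then have "NF \<sigma> \<Gamma> (mode_of C) (L @ [(x, A)] @ M @ R)
      \<subseteq> NF \<sigma> \<Gamma> (mode_of C) (L @ [(x, A)] @ M @ [(x, A)] @ R)"
    using r_ContrL unfolding NF_def by fast
  with e_ContrL show ?case by fast
next
  case (e_MobR \<Gamma> C L x A M R)
  then have "NF \<sigma> \<Gamma> (mode_of C) (L @ M @ [(x, A)] @ R)
      \<subseteq> NF \<sigma> \<Gamma> (mode_of C) (L @ [(x, A)] @ M @ R)"
    using r_MobR unfolding NF_def by fast
  with e_MobR show ?case by fast
next
  case (e_MobL \<Gamma> C L M x A R)
  then have "NF \<sigma> \<Gamma> (mode_of C) (L @ [(x, A)] @ M @ R)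
      \<subseteq> NF \<sigma> \<Gamma> (mode_of C) (L @ M @ [(x, A)] @ R)"
    using r_MobL unfolding NF_def by fast
  with e_MobL show ?case by fast
qed

end
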